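(* Let $\mathcal{H}$ be a normalized complete Pick space, let $M,N\in\mathbb{N}$ and let $\psi_{ij}\in\operatorname{Mult}(\mathcal{H})$ for $1\le i\le M$ and $1\le j\le N$. Then $$\left\| \begin{bmatrix} \psi_{11}&\cdots&\psi_{1N}\\ \psi_{21}&\cdots&\psi_{2N}\\ \vdots&\ddots&\vdots\\ \psi_{M1}&\cdots&\psi_{MN}\end{bmatrix}\right\|_{\operatorname{Mult}(\mathcal{H}\otimes\mathbb{C}^N,\mathcal{H}\otimes\mathbb{C}^M)} \le \left\|\begin{bmatrix}\psi_{11}\\ \vdots\\ \psi_{M1}\\ \psi_{12}\\ \vdots\\ \psi_{MN}\end{bmatrix}\right\|_{\operatorname{Mult}(\mathcal{H},\mathcal{H}\otimes\mathbb{C}^{NM})}.$$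
   Context: All reproducing kernel Hilbert spaces (RKHS) consist of complex-valued functions on a set $X$ and are assumed separable. For an RKHS $\mathcal{H}$, $\operatorname{Mult}(\mathcal{H})$ is the algebra of functions $\varphi:X\to\mathbb{C}$ with $\varphi f\in\mathcal{H}$ for all $f\in\mathcal{H}$. An $N'\times M'$ matrix of multipliers is identified with the multiplication operator $\mathcal{H}\otimes\mathbb{C}^{M'}\to\mathcal{H}\otimes\mathbb{C}^{N'}$ it induces (matrix of the multiplication operators $M_{\varphi_{ij}}$), and $\|\cdot\|_{\operatorname{Mult}(\mathcal{H}\otimes\mathbb{C}^{M'},\mathcal{H}\otimes\mathbb{C}^{N'})}$ is its operator norm. Normalized complete Pick space: an RKHS $\mathcal{H}$ on $X$ with kernel $K$ such that there is $z_0\in X$ with $K(z,z_0)=1$ for all $z\in X$, and $\mathcal{H}$ has the complete Pick property: for every finite $Y\subset X$ and all $M,N\in\mathbb{N}$, the restriction map from $N\times M$ matrices of multipliers of $\mathcal{H}$ to $N\times M$ matrices of multipliers of $\mathcal{H}|_Y$ (the RKHS on $Y$ with kernel $K|_{Y\times Y}$) maps the closed unit ball onto the closed unit ball. Equivalently (Agler--McCarthy, McCullough, Quiggin), there are $d\in\mathbb{N}\cup\{\infty\}$ and $b:X\to\mathbb{B}_d$ with $b(z_0)=0$ and $K(z,w)=\frac{1}{1-\langle b(z),b(w)\rangle}$ for all $z,w \in X$, where $\mathbb{B}_d$ is the open unit ball of $\mathbb{C}^d$ (of $\ell^2$ if $d=\infty$). Either description may be taken as the definition. *)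

theory Defs
  imports "HOL-Analysis.Analysis"
begin

section \<open>Reproducing kernel Hilbert spaces\<close>

text \<open>
  The underlying set \<open>X\<close> is the type \<open>'x\<close>. A Hilbert function space is a set \<open>H\<close> of functions
  on it together with an inner product \<open>ip\<close>, linear in the first argument; \<open>ip\<close> is only
  meaningful on \<open>H\<close>.
\<close>

locale inner_product_function_space =
  fixes H :: "('x \<Rightarrow> complex) set"
    and ip :: "('x \<Rightarrow> complex) \<Rightarrow> ('x \<Rightarrow> complex) \<Rightarrow> complex"
  assumes zero_mem: "(\<lambda>x. 0) \<in> H"
    and add_mem: "\<lbrakk>f \<in> H; g \<in> H\<rbrakk> \<Longrightarrow> (\<lambda>x. f x + g x) \<in> H"
    and scale_mem: "f \<in> H \<Longrightarrow> (\<lambda>x. c * f x) \<in> H"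
    and ip_add: "\<lbrakk>f \<in> H; g \<in> H; h \<in> H\<rbrakk> \<Longrightarrow> ip (\<lambda>x. f x + g x) h = ip f h + ip g h"
    and ip_scale: "\<lbrakk>f \<in> H; h \<in> H\<rbrakk> \<Longrightarrow> ip (\<lambda>x. c * f x) h = c * ip f h"
    and ip_cnj: "\<lbrakk>f \<in> H; g \<in> H\<rbrakk> \<Longrightarrow> ip g f = cnj (ip f g)"
    and ip_nonneg: "f \<in> H \<Longrightarrow> 0 \<le> Re (ip f f)"
    and ip_definite: "\<lbrakk>f \<in> H; ip f f = 0\<rbrakk> \<Longrightarrow> f = (\<lambda>x. 0)"

text \<open>
  The totalization outside \<open>H\<close> is only there because \<^locale>\<open>Metric_space\<close> requires
  nonnegativity and symmetry on the whole type.
\<close>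

definition ip_dist ::
  "('x \<Rightarrow> complex) set \<Rightarrow> (('x \<Rightarrow> complex) \<Rightarrow> ('x \<Rightarrow> complex) \<Rightarrow> complex)
    \<Rightarrow> ('x \<Rightarrow> complex) \<Rightarrow> ('x \<Rightarrow> complex) \<Rightarrow> real"
  where "ip_dist H ip f g =
    (if f \<in> H \<and> g \<in> H then sqrt (Re (ip (\<lambda>x. f x - g x) (\<lambda>x. f x - g x))) else 0)"

context inner_product_function_space
begin

lemma diff_mem: "\<lbrakk>f \<in> H; g \<in> H\<rbrakk> \<Longrightarrow> (\<lambda>x. f x - g x) \<in> H"
  using add_mem[of f "\<lambda>x. (-1) * g x"] scale_mem[of g "-1"] by simp

lemma ip_self_add_scale:
  fixes t :: real
  assumes f: "f \<in> H" and g: "g \<in> H"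
  shows "Re (ip (\<lambda>x. f x + of_real t * g x) (\<lambda>x. f x + of_real t * g x)) =
    Re (ip f f) + 2 * t * Re (ip f g) + t\<^sup>2 * Re (ip g g)"
proof -
  define u where "u = (\<lambda>x. of_real t * g x)"
  define v where "v = (\<lambda>x. f x + u x)"
  have u: "u \<in> H" and v: "v \<in> H"
    unfolding v_def u_def using f g add_mem scale_mem by auto
  have ug: "ip u h = of_real t * ip g h" if "h \<in> H" for h
    unfolding u_def using ip_scale[OF g that] .
  have vh: "ip v h = ip f h + ip u h" if "h \<in> H" for h
    unfolding v_def using ip_add[OF f u that] .
  have "Re (ip v v) = Re (ip f v) + Re (ip u v)" by (simp add: vh[OF v])
  also have "Re (ip f v) = Re (ip f f) + t * Re (ip f g)"
    using ip_cnj[OF v f] ip_cnj[OF g f] by (simp add: vh[OF f] ug[OF f])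
  also have "Re (ip u v) = t * Re (ip f g) + t * (t * Re (ip g g))"
    using ip_cnj[OF v g] by (simp add: ug[OF v] vh[OF g] ug[OF g] algebra_simps)
  finally show ?thesis
    unfolding v_def u_def by (simp add: power2_eq_square algebra_simps)
qed

lemma Re_ip_Cauchy_Schwarz:
  assumes f: "f \<in> H" and g: "g \<in> H"
  shows "Re (ip f g) \<le> sqrt (Re (ip f f)) * sqrt (Re (ip g g))"
proof (cases "Re (ip g g) = 0")
  case True
  have "ip g g = 0"
    using True ip_cnj[OF g g] by (simp add: complex_eq_iff)
  then have "g = (\<lambda>x. 0)" by (rule ip_definite[OF g])
  then have "ip g f = 0" using ip_scale[OF g f, of 0] by simp
  then have "Re (ip f g) = 0" using ip_cnj[OF g f] by simp
  then show ?thesis using True by simp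
next
  case False
  define a b c where abc: "a = Re (ip f f)" "b = Re (ip f g)" "c = Re (ip g g)"
  have c: "c > 0" using False ip_nonneg[OF g] abc by simp
  have "0 \<le> a + 2 * (- b / c) * b + (- b / c)\<^sup>2 * c"
    using ip_nonneg[OF add_mem[OF f scale_mem[OF g]], of "of_real (- b / c)"]
    unfolding ip_self_add_scale[OF f g] abc by simp
  also have "\<dots> = a - b\<^sup>2 / c" using c by (simp add: field_simps power2_eq_square)
  finally have "b\<^sup>2 \<le> a * c" using c by (simp add: field_simps)
  then have "\<bar>b\<bar> \<le> sqrt (a * c)"
    by (metis real_sqrt_abs real_sqrt_le_iff)
  then show ?thesis unfolding abc real_sqrt_mult by simp
qed

lemma Metric_space_ip_dist: "Metric_space H (ip_dist H ip)"
proof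
  show "0 \<le> ip_dist H ip f g" for f g
    by (simp add: ip_dist_def ip_nonneg diff_mem)
  show "ip_dist H ip f g = ip_dist H ip g f" for f g
  proof (cases "f \<in> H \<and> g \<in> H")
    case True
    have "Re (ip (\<lambda>x. g x - f x) (\<lambda>x. g x - f x)) = Re (ip (\<lambda>x. f x - g x) (\<lambda>x. f x - g x))"
      using ip_self_add_scale[OF zero_mem diff_mem[of f g], of "-1"] True
        ip_scale[OF zero_mem zero_mem, of 0] ip_scale[OF zero_mem diff_mem[of f g], of 0]
      by simp
    then show ?thesis using True by (simp add: ip_dist_def)
  qed (auto simp: ip_dist_def)
  show "ip_dist H ip f g = 0 \<longleftrightarrow> f = g" if "f \<in> H" "g \<in> H" for f g
  proof
    let ?d = "\<lambda>x. f x - g x"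
    have d: "?d \<in> H" using that diff_mem by blast
    assume "ip_dist H ip f g = 0"
    then have "Re (ip ?d ?d) = 0" using that by (simp add: ip_dist_def)
    then have "ip ?d ?d = 0" using ip_cnj[OF d d] by (simp add: complex_eq_iff)
    then have "?d = (\<lambda>x. 0)" by (rule ip_definite[OF d])
    then show "f = g" by (auto simp: fun_eq_iff)
  next
    assume "f = g"
    then show "ip_dist H ip f g = 0"
      using that ip_scale[OF zero_mem zero_mem, of 0] by (simp add: ip_dist_def)
  qed
  show "ip_dist H ip f h \<le> ip_dist H ip f g + ip_dist H ip g h"
    if f: "f \<in> H" and g: "g \<in> H" and h: "h \<in> H" for f g h
  proof -
    define u v where uv: "u = (\<lambda>x. f x - g x)" "v = (\<lambda>x. g x - h x)"
    have u: "u \<in> H" and v: "v \<in> H" using uv f g h diff_mem by auto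
    have fh: "(\<lambda>x. f x - h x) = (\<lambda>x. u x + of_real 1 * v x)" by (auto simp: uv)
    have "Re (ip (\<lambda>x. f x - h x) (\<lambda>x. f x - h x)) =
        Re (ip u u) + 2 * Re (ip u v) + Re (ip v v)"
      unfolding fh ip_self_add_scale[OF u v] by simp
    also have "\<dots> \<le> (sqrt (Re (ip u u)) + sqrt (Re (ip v v)))\<^sup>2"
      using Re_ip_Cauchy_Schwarz[OF u v] ip_nonneg[OF u] ip_nonneg[OF v]
      by (simp add: power2_sum)
    finally have "sqrt (Re (ip (\<lambda>x. f x - h x) (\<lambda>x. f x - h x))) \<le>
        sqrt (Re (ip u u)) + sqrt (Re (ip v v))"
      using ip_nonneg[OF u] ip_nonneg[OF v] by (intro real_le_lsqrt) auto
    then show ?thesis using f g h by (simp add: ip_dist_def uv)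
  qed
qed

end

locale separable_rkhs = inner_product_function_space H ip
  for H :: "('x \<Rightarrow> complex) set" and ip +
  fixes K :: "'x \<Rightarrow> 'x \<Rightarrow> complex"
  assumes complete: "Metric_space.mcomplete H (ip_dist H ip)"
    and separable: "separable_space (Metric_space.mtopology H (ip_dist H ip))"
    and kernel_mem: "(\<lambda>z. K z w) \<in> H"
    and reproducing: "f \<in> H \<Longrightarrow> ip f (\<lambda>z. K z w) = f w"

section \<open>Normalized complete Pick spaces\<close>

text \<open>
  The open unit ball of \<open>\<complex>\<^sup>d\<close> for finite \<open>d\<close>, and of \<open>\<ell>\<^sup>2\<close> for \<open>d = \<infinity>\<close>. Vectors in \<open>\<complex>\<^sup>d\<close> are
  sequences vanishing from index \<open>d\<close> on.
\<close>

definition unit_ball :: "enat \<Rightarrow> (nat \<Rightarrow> complex) set"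
  where "unit_ball d = {v. (\<forall>n. d \<le> enat n \<longrightarrow> v n = 0) \<and>
    summable (\<lambda>n. (cmod (v n))\<^sup>2) \<and> (\<Sum>n. (cmod (v n))\<^sup>2) < 1}"

text \<open>
  Complete Pick spaces are given by their Agler--McCarthy embedding into the unit ball;
  the series is the inner product of \<open>b z\<close> and \<open>b w\<close>.
\<close>

locale normalized_complete_pick_space = separable_rkhs H ip K
  for H :: "('x \<Rightarrow> complex) set" and ip and K +
  assumes ball_embedding: "\<exists>d z0 b. range b \<subseteq> unit_ball d \<and> b z0 = (\<lambda>n. 0) \<and>
    (\<forall>z w. K z w = 1 / (1 - (\<Sum>n. b z n * cnj (b w n))))"

section \<open>Multipliers\<close>

definition Mult :: "('x \<Rightarrow> complex) set \<Rightarrow> ('x \<Rightarrow> complex) set"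
  where "Mult H = {\<phi>. \<forall>f\<in>H. (\<lambda>x. \<phi> x * f x) \<in> H}"

text \<open>
  The space \<open>H \<otimes> \<complex>\<^sup>n\<close> consists of the \<open>n\<close>-tuples of elements of \<open>H\<close>, indexed from \<open>0\<close>, with the
  Hilbert space direct sum norm.
\<close>

definition tensor_Cn :: "('x \<Rightarrow> complex) set \<Rightarrow> nat \<Rightarrow> (nat \<Rightarrow> 'x \<Rightarrow> complex) set"
  where "tensor_Cn H n = {..<n} \<rightarrow>\<^sub>E H"

definition tensor_norm ::
  "(('x \<Rightarrow> complex) \<Rightarrow> ('x \<Rightarrow> complex) \<Rightarrow> complex) \<Rightarrow> nat \<Rightarrow> (nat \<Rightarrow> 'x \<Rightarrow> complex) \<Rightarrow> real"
  where "tensor_norm ip n F = sqrt (\<Sum>i<n. Re (ip (F i) (F i)))"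

definition mult_operator ::
  "nat \<Rightarrow> nat \<Rightarrow> (nat \<Rightarrow> nat \<Rightarrow> 'x \<Rightarrow> complex) \<Rightarrow> (nat \<Rightarrow> 'x \<Rightarrow> complex) \<Rightarrow> nat \<Rightarrow> 'x \<Rightarrow> complex"
  where "mult_operator m n \<Psi> F = (\<lambda>i\<in>{..<m}. \<lambda>x. \<Sum>j<n. \<Psi> i j x * F j x)"

text \<open>
  The operator norm of an \<open>m \<times> n\<close> matrix \<open>\<Psi>\<close> of multipliers, from \<open>H \<otimes> \<complex>\<^sup>n\<close> to \<open>H \<otimes> \<complex>\<^sup>m\<close>.
  It is taken in \<open>[0, \<infinity>]\<close>, so that the supremum is meaningful without a boundedness proof;
  on an RKHS it is finite by the closed graph theorem.
\<close>

definition mult_norm ::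
  "('x \<Rightarrow> complex) set \<Rightarrow> (('x \<Rightarrow> complex) \<Rightarrow> ('x \<Rightarrow> complex) \<Rightarrow> complex)
    \<Rightarrow> nat \<Rightarrow> nat \<Rightarrow> (nat \<Rightarrow> nat \<Rightarrow> 'x \<Rightarrow> complex) \<Rightarrow> ennreal"
  where "mult_norm H ip m n \<Psi> =
    (SUP F \<in> {F \<in> tensor_Cn H n. tensor_norm ip n F \<le> 1}.
      ennreal (tensor_norm ip m (mult_operator m n \<Psi> F)))"

text \<open>
  The columns of an \<open>m\<close>-row matrix stacked into one column, as an \<open>m * n\<close> by \<open>1\<close> matrix:
  entry \<open>k = j * m + i\<close> is \<open>\<Psi> i j\<close>.
\<close>

definition stacked_column ::
  "nat \<Rightarrow> (nat \<Rightarrow> nat \<Rightarrow> 'x \<Rightarrow> complex) \<Rightarrow> nat \<Rightarrow> nat \<Rightarrow> 'x \<Rightarrow> complex"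
  where "stacked_column m \<Psi> = (\<lambda>k _. \<Psi> (k mod m) (k div m))"

end

theory Submission
  imports Defs
begin

text \<open>
  All norms are rephrased as positivity of kernels on finite sets: with \<open>K = 1 / (1 - B)\<close>, a column
  \<open>\<Phi>\<close> is contractive iff \<open>K (1 - \<Phi> \<Phi>\<^sup>*)\<close> is positive semidefinite, where \<open>\<Phi> \<Phi>\<^sup>*\<close> is a matrix,
  and a row iff the same holds with the scalar \<open>\<Phi>\<^sup>T (\<Phi>\<^sup>T)\<^sup>*\<close>.

  Every tuple \<open>F\<close> of elements of the space factors as \<open>\<Theta> h\<close> with a contractive column \<open>\<Theta>\<close> and
  \<open>\<parallel>h\<parallel> \<le> \<parallel>F\<parallel>\<close>: the decreasing Riccati iteration that replaces \<open>J\<close> by the largest positive kernel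
  below \<open>1 + B J\<close> annihilating \<open>F\<close> has a limit of the form \<open>K (1 - \<Theta> \<Theta>\<^sup>*)\<close>. If contractive columns are contractive
  rows, then commutativity gives \<open>\<psi> F = (\<Theta>\<^sup>T \<psi>) h\<close>, where the row \<open>\<Theta>\<^sup>T\<close> acts on the stacked column
  of \<open>\<psi>\<close>; this bounds the matrix by the stacked column.

  That contractive columns are contractive rows follows by induction on the number of points. A ball
  automorphism makes the column vanish at one point \<open>x\<close>, and the Schur complement \<open>L\<close> of \<open>K\<close> at \<open>x\<close>
  is \<open>K\<close> times a positive kernel, so the factorization argument on the remaining points applies with
  target kernel \<open>L\<close>.
\<close>

section \<open>Positive semidefinite kernels on finite sets\<close>

text \<open>At a fixed point of the iteration, \<open>J\<close> is \<open>1 + B J\<close> minus a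
  rank-one term, so \<open>(1 - B) J\<close> is \<open>1\<close> minus that term; multiplying by
  \<open>K = 1 / (1 - B)\<close> gives the announced form of the limit.

  The obstacle is circularity. The bound for a matrix uses that the transpose of
  \<open>\<Theta>\<close> is contractive, and this is the one-row case of the bound itself.
  Induction on points breaks the circle: a contractive column that vanishes at \<open>x\<close> maps
  into the functions vanishing at \<open>x\<close>, whose kernel is \<open>L = K P\<close> with
  \<open>P\<close> positive, and the bound into that smaller space uses contractive rows only on the
  points other than \<open>x\<close>. This is why the central inequalities carry an extra factor
  \<open>P\<close>.

  Three degenerate cases are handled by approximation. Deflation is well behaved only if the form of
  the constant kernel \<open>1\<close> is positive at the vector, so one coefficient is perturbed.
  The ball automorphism requires values strictly inside the ball, so columns are scaled by
  \<open>n / (n + 1)\<close>. The final division by the norm of the stacked column requires a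
  positive number, so \<open>e\<close> is added.\<close>

definition sesq :: "'a set \<Rightarrow> ('a \<Rightarrow> 'a \<Rightarrow> complex) \<Rightarrow> ('a \<Rightarrow> complex) \<Rightarrow> ('a \<Rightarrow> complex) \<Rightarrow> complex"
  where "sesq S A y v = (\<Sum>p\<in>S. \<Sum>q\<in>S. y p * cnj (v q) * A p q)"

text \<open>The second clause sees only the real part of the form. Hermitian symmetry does not
  follow from it and is therefore a separate clause.\<close>

definition psd :: "'a set \<Rightarrow> ('a \<Rightarrow> 'a \<Rightarrow> complex) \<Rightarrow> bool"
  where "psd S A \<longleftrightarrow> (\<forall>p\<in>S. \<forall>q\<in>S. A q p = cnj (A p q)) \<and> (\<forall>y. 0 \<le> Re (sesq S A y y))"

lemma psdI:
  assumes "\<And>p q. p \<in> S \<Longrightarrow> q \<in> S \<Longrightarrow> A q p = cnj (A p q)" "\<And>y. 0 \<le> Re (sesq S A y y)"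
  shows "psd S A"
  unfolding psd_def using assms by blast

lemma psd_herm: "psd S A \<Longrightarrow> p \<in> S \<Longrightarrow> q \<in> S \<Longrightarrow> A q p = cnj (A p q)"
  unfolding psd_def by blast

lemma psd_nonneg: "psd S A \<Longrightarrow> 0 \<le> Re (sesq S A y y)"
  unfolding psd_def by blast

lemma sesq_cong:
  assumes "\<And>p q. p \<in> S \<Longrightarrow> q \<in> S \<Longrightarrow> A p q = B p q"
    "\<And>p. p \<in> S \<Longrightarrow> y p = y' p" "\<And>p. p \<in> S \<Longrightarrow> v p = v' p"
  shows "sesq S A y v = sesq S B y' v'"
  unfolding sesq_def using assms by (auto intro!: sum.cong)

lemma psd_cong:
  assumes "\<And>p q. p \<in> S \<Longrightarrow> q \<in> S \<Longrightarrow> A p q = B p q"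
  shows "psd S A \<longleftrightarrow> psd S B"
proof -
  have "sesq S A y y = sesq S B y y" for y by (rule sesq_cong) (use assms in auto)
  moreover have "(\<forall>p\<in>S. \<forall>q\<in>S. A q p = cnj (A p q)) \<longleftrightarrow> (\<forall>p\<in>S. \<forall>q\<in>S. B q p = cnj (B p q))"
    using assms by metis
  ultimately show ?thesis unfolding psd_def by metis
qed

section \<open>Algebra of sesquilinear forms\<close>

lemma sesq_add_left: "sesq S A (\<lambda>p. y p + z p) v = sesq S A y v + sesq S A z v"
  by (simp add: sesq_def distrib_right sum.distrib)

lemma sesq_add_right: "sesq S A v (\<lambda>p. y p + z p) = sesq S A v y + sesq S A v z"
  by (simp add: sesq_def distrib_left distrib_right sum.distrib)

lemma sesq_scale_left: "sesq S A (\<lambda>p. c * y p) v = c * sesq S A y v"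
  by (simp add: sesq_def sum_distrib_left mult.assoc)

lemma sesq_scale_right: "sesq S A v (\<lambda>p. c * y p) = cnj c * sesq S A v y"
  by (simp add: sesq_def sum_distrib_left mult_ac)

lemma sesq_add: "sesq S (\<lambda>p q. A p q + B p q) y v = sesq S A y v + sesq S B y v"
  by (simp add: sesq_def distrib_left sum.distrib)

lemma sesq_diff: "sesq S (\<lambda>p q. A p q - B p q) y v = sesq S A y v - sesq S B y v"
  by (simp add: sesq_def right_diff_distrib sum_subtractf)

lemma sesq_cmult: "sesq S (\<lambda>p q. c * A p q) y v = c * sesq S A y v"
  by (simp add: sesq_def sum_distrib_left mult_ac)

lemma sesq_outer:
  "sesq S (\<lambda>p q. u p * cnj (u q)) y v = (\<Sum>p\<in>S. y p * u p) * cnj (\<Sum>p\<in>S. v p * u p)"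
  unfolding sesq_def cnj_sum sum_product by (simp add: mult_ac)

lemma sesq_congruence: "sesq S (\<lambda>p q. u p * cnj (u q) * A p q) y v = sesq S A (\<lambda>p. y p * u p) (\<lambda>p. v p * u p)"
  by (simp add: sesq_def mult_ac)

lemma sesq_cnj:
  assumes "psd S A"
  shows "sesq S A v y = cnj (sesq S A y v)"
proof -
  have "cnj (sesq S A y v) = (\<Sum>p\<in>S. \<Sum>q\<in>S. v q * cnj (y p) * A q p)"
    unfolding sesq_def cnj_sum
  proof (intro sum.cong refl)
    show "cnj (y p * cnj (v q) * A p q) = v q * cnj (y p) * A q p" if "p \<in> S" "q \<in> S" for p q
      using psd_herm[OF assms that] by simp
  qed
  also have "\<dots> = sesq S A v y" unfolding sesq_def by (rule sum.swap)
  finally show ?thesis ..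
qed

lemma sesq_self_real:
  assumes "psd S A"
  shows "sesq S A y y = of_real (Re (sesq S A y y))"
  using sesq_cnj[OF assms, of y y] by (simp add: complex_eq_iff)

lemma psd_add: "psd S A \<Longrightarrow> psd S B \<Longrightarrow> psd S (\<lambda>p q. A p q + B p q)"
  by (rule psdI) (simp_all add: sesq_add psd_nonneg flip: psd_herm[of S A] psd_herm[of S B])

lemma psd_cmult: "psd S A \<Longrightarrow> 0 \<le> c \<Longrightarrow> psd S (\<lambda>p q. complex_of_real c * A p q)"
  by (rule psdI) (simp_all add: sesq_cmult psd_nonneg flip: psd_herm[of S A])

lemma psd_outer: "psd S (\<lambda>p q. u p * cnj (u q))"
proof (rule psdI)
  show "0 \<le> Re (sesq S (\<lambda>p q. u p * cnj (u q)) y y)" for y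
    unfolding sesq_outer complex_norm_square[symmetric] by simp
qed simp

lemma psd_congruence: "psd S A \<Longrightarrow> psd S (\<lambda>p q. u p * cnj (u q) * A p q)"
  by (rule psdI) (simp_all add: sesq_congruence psd_nonneg flip: psd_herm[of S A])

lemma psd_subset:
  assumes "psd S A" "T \<subseteq> S" "finite S"
  shows "psd T A"
proof (rule psdI)
  fix y :: "'a \<Rightarrow> complex"
  let ?y = "\<lambda>p. if p \<in> T then y p else 0"
  have "sesq S A ?y ?y = sesq T A y y"
    unfolding sesq_def
    by (intro sum.mono_neutral_cong_right) (use assms in \<open>auto intro!: sum.mono_neutral_cong_right\<close>)
  then show "0 \<le> Re (sesq T A y y)" using psd_nonneg[OF assms(1), of ?y] by simp
qed (use assms psd_herm[OF assms(1)] in blast)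

text \<open>\<open>f\<close> may identify points: the coefficients are added up along its fibres.
  With \<open>fst\<close> and \<open>snd\<close> this transports kernels on \<open>Y\<close> and on
  the index set to \<open>Y \<times> {..<N}\<close>.\<close>

lemma sesq_pullback:
  assumes "finite S" "finite T" "f ` S \<subseteq> T"
  shows "sesq S (\<lambda>p q. A (f p) (f q)) y v =
    sesq T A (\<lambda>z. \<Sum>p\<in>{p\<in>S. f p = z}. y p) (\<lambda>z. \<Sum>p\<in>{p\<in>S. f p = z}. v p)"
proof -
  have group: "(\<Sum>p\<in>S. g p) = (\<Sum>z\<in>T. \<Sum>p\<in>{p\<in>S. f p = z}. g p)" for g :: "'a \<Rightarrow> complex"
    by (rule sum.group[OF assms, symmetric])
  have "sesq S (\<lambda>p q. A (f p) (f q)) y v =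
      (\<Sum>z\<in>T. \<Sum>p\<in>{p\<in>S. f p = z}. \<Sum>w\<in>T. \<Sum>q\<in>{q\<in>S. f q = w}. y p * cnj (v q) * A (f p) (f q))"
    unfolding sesq_def group[symmetric] ..
  also have "\<dots> = (\<Sum>z\<in>T. \<Sum>w\<in>T. \<Sum>p\<in>{p\<in>S. f p = z}. \<Sum>q\<in>{q\<in>S. f q = w}. y p * cnj (v q) * A (f p) (f q))"
    by (intro sum.cong refl sum.swap)
  also have "\<dots> = sesq T A (\<lambda>z. \<Sum>p\<in>{p\<in>S. f p = z}. y p) (\<lambda>z. \<Sum>p\<in>{p\<in>S. f p = z}. v p)"
    unfolding sesq_def cnj_sum sum_product unfolding sum_distrib_right by (intro sum.cong) auto
  finally show ?thesis .
qed

lemma psd_pullback: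
  assumes "psd T A" "finite S" "finite T" "f ` S \<subseteq> T"
  shows "psd S (\<lambda>p q. A (f p) (f q))"
proof (rule psdI)
  show "A (f q) (f p) = cnj (A (f p) (f q))" if "p \<in> S" "q \<in> S" for p q
    using psd_herm[OF assms(1)] assms(4) that by blast
qed (simp only: sesq_pullback[OF assms(2-4)] psd_nonneg[OF assms(1)])

lemma sesq_indicator_right:
  assumes "finite S" "x \<in> S"
  shows "sesq S A y (\<lambda>p. of_bool (p = x)) = (\<Sum>p\<in>S. y p * A p x)"
proof -
  have "(\<Sum>q\<in>S. y p * cnj (of_bool (q = x)) * A p q) = y p * A p x" for p
  proof -
    have "(\<Sum>q\<in>S. y p * cnj (of_bool (q = x)) * A p q) = (\<Sum>q\<in>S. if q = x then y p * A p x else 0)"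
      by (intro sum.cong) auto
    then show ?thesis using assms by simp
  qed
  then show ?thesis unfolding sesq_def by simp
qed

lemma sesq_indicators:
  assumes "finite S" "x \<in> S" "z \<in> S"
  shows "sesq S A (\<lambda>p. of_bool (p = z)) (\<lambda>p. of_bool (p = x)) = A z x"
proof -
  have "(\<Sum>p\<in>S. of_bool (p = z) * A p x) = (\<Sum>p\<in>S. if p = z then A z x else 0)"
    by (intro sum.cong) auto
  then show ?thesis using assms by (simp add: sesq_indicator_right)
qed

lemma sesq_add_scale:
  assumes "psd S A"
  shows "Re (sesq S A (\<lambda>p. y p + c * v p) (\<lambda>p. y p + c * v p)) =
    Re (sesq S A y y) + 2 * Re (cnj c * sesq S A y v) + (cmod c)\<^sup>2 * Re (sesq S A v v)"
proof -
  have "sesq S A (\<lambda>p. y p + c * v p) (\<lambda>p. y p + c * v p) =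
      sesq S A y y + (cnj c * sesq S A y v + cnj (cnj c * sesq S A y v)) + (c * cnj c) * sesq S A v v"
    by (simp add: sesq_add_left sesq_add_right sesq_scale_left sesq_scale_right
        sesq_cnj[OF assms, of v y] algebra_simps)
  then show ?thesis unfolding complex_norm_square[symmetric] by simp
qed

lemma psd_Cauchy_Schwarz:
  assumes "psd S A"
  shows "(cmod (sesq S A y v))\<^sup>2 \<le> Re (sesq S A y y) * Re (sesq S A v v)"
proof -
  define s a b where sab: "s = sesq S A y v" "a = Re (sesq S A y y)" "b = Re (sesq S A v v)"
  \<comment> \<open>This is the form at \<open>y - t s v\<close>; the factor \<open>s\<close> makes
    the cross term real.\<close>
  have *: "0 \<le> a - 2 * t * (cmod s)\<^sup>2 + t\<^sup>2 * (cmod s)\<^sup>2 * b" for t :: real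
  proof -
    have "Re (cnj (- of_real t * s) * s) = - t * (cmod s)\<^sup>2"
      by (simp add: cmod_def power2_eq_square algebra_simps)
    moreover have "(cmod (- of_real t * s))\<^sup>2 = t\<^sup>2 * (cmod s)\<^sup>2"
      by (simp add: norm_mult power_mult_distrib)
    moreover have "0 \<le> a + 2 * Re (cnj (- of_real t * s) * s) + (cmod (- of_real t * s))\<^sup>2 * b"
      using psd_nonneg[OF assms, of "\<lambda>p. y p + (- of_real t * s) * v p"]
      unfolding sesq_add_scale[OF assms] sab .
    ultimately show ?thesis by simp
  qed
  have a: "0 \<le> a" and b: "0 \<le> b" using psd_nonneg[OF assms] sab by auto
  have "(cmod s)\<^sup>2 \<le> a * b"
  proof (cases "b = 0")
    case True
    have "(cmod s)\<^sup>2 = 0"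
    proof (rule ccontr)
      assume "(cmod s)\<^sup>2 \<noteq> 0"
      \<comment> \<open>With \<open>b = 0\<close> the bound is affine in \<open>t\<close>, and this
        \<open>t\<close> gives it the value \<open>-1\<close>.\<close>
      then show False using *[of "(a + 1) / (2 * (cmod s)\<^sup>2)"] True by simp
    qed
    then show ?thesis using True by simp
  next
    case False
    then have "b > 0" using b by simp
    then show ?thesis using *[of "1 / b"] by (simp add: field_simps power2_eq_square)
  qed
  then show ?thesis by (simp add: sab)
qed

lemma psd_entry_bound:
  assumes "psd S A" "finite S" "p \<in> S" "q \<in> S"
  shows "(cmod (A p q))\<^sup>2 \<le> Re (A p p) * Re (A q q)"
  using psd_Cauchy_Schwarz[OF assms(1), of "\<lambda>r. of_bool (r = p)" "\<lambda>r. of_bool (r = q)"] assms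
  by (simp add: sesq_indicators)

lemma psd_diag:
  assumes "psd S A" "finite S" "p \<in> S"
  shows "0 \<le> Re (A p p)" "A p p = of_real (Re (A p p))"
  using psd_nonneg[OF assms(1), of "\<lambda>r. of_bool (r = p)"] psd_herm[OF assms(1,3,3)] assms
  by (simp_all add: sesq_indicators complex_eq_iff)

text \<open>Domination of a rank-one kernel by duality: it suffices that the functional with
  coefficients \<open>u\<close> is bounded by the form of \<open>A\<close>. The converse is
  \<open>psd_Cauchy_outer_diff\<close>.\<close>

lemma psd_outer_diff:
  assumes "psd S A" "\<And>y. (cmod (\<Sum>p\<in>S. y p * u p))\<^sup>2 \<le> Re (sesq S A y y)"
  shows "psd S (\<lambda>p q. A p q - u p * cnj (u q))"
proof (rule psdI)
  fix y
  have "Re ((\<Sum>p\<in>S. y p * u p) * cnj (\<Sum>p\<in>S. y p * u p)) = (cmod (\<Sum>p\<in>S. y p * u p))\<^sup>2"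
    unfolding complex_norm_square[symmetric] by simp
  then show "0 \<le> Re (sesq S (\<lambda>p q. A p q - u p * cnj (u q)) y y)"
    unfolding sesq_diff sesq_outer using assms(2)[of y] by simp
qed (simp add: mult.commute flip: psd_herm[OF assms(1)])

text \<open>
  The largest positive semidefinite kernel below \<open>A\<close> whose form vanishes at \<open>v\<close>; if the form of
  \<open>A\<close> already vanishes there, division by zero makes this \<open>A\<close> itself.
\<close>

definition deflate :: "'a set \<Rightarrow> ('a \<Rightarrow> complex) \<Rightarrow> ('a \<Rightarrow> 'a \<Rightarrow> complex) \<Rightarrow> 'a \<Rightarrow> 'a \<Rightarrow> complex"
  where "deflate S v A p q = A p q -
    (\<Sum>r\<in>S. cnj (v r) * A p r) * cnj (\<Sum>r\<in>S. cnj (v r) * A q r) / of_real (Re (sesq S A v v))"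

section \<open>Deflation, Schur complements and Schur products\<close>

lemma sesq_deflate:
  "sesq S (deflate S v A) y z =
    sesq S A y z - sesq S A y v * cnj (sesq S A z v) / of_real (Re (sesq S A v v))"
proof -
  define c where "c = 1 / complex_of_real (Re (sesq S A v v))"
  have d: "deflate S v A = (\<lambda>p q. A p q -
      c * ((\<Sum>r\<in>S. cnj (v r) * A p r) * cnj (\<Sum>r\<in>S. cnj (v r) * A q r)))"
    by (simp add: deflate_def c_def fun_eq_iff)
  have s: "(\<Sum>p\<in>S. y p * (\<Sum>r\<in>S. cnj (v r) * A p r)) = sesq S A y v" for y
    by (simp add: sesq_def sum_distrib_left mult.assoc)
  show ?thesis unfolding d sesq_diff sesq_cmult sesq_outer s by (simp add: c_def)
qed

lemma Re_sesq_deflate: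
  "Re (sesq S (deflate S v A) y y) =
    Re (sesq S A y y) - (cmod (sesq S A y v))\<^sup>2 / Re (sesq S A v v)"
  unfolding sesq_deflate complex_norm_square[symmetric] by (simp flip: of_real_divide)

lemma psd_deflate:
  assumes "psd S A"
  shows "psd S (deflate S v A)"
proof (rule psdI)
  show "0 \<le> Re (sesq S (deflate S v A) y y)" for y
    unfolding Re_sesq_deflate using psd_Cauchy_Schwarz[OF assms, of y v] psd_nonneg[OF assms, of v]
      psd_nonneg[OF assms, of y]
    by (cases "Re (sesq S A v v) = 0") (simp_all add: field_simps)
next
  fix p q assume "p \<in> S" "q \<in> S"
  then show "deflate S v A q p = cnj (deflate S v A p q)"
    unfolding deflate_def by (simp add: mult.commute flip: psd_herm[OF assms])
qed

lemma psd_diff_deflate: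
  assumes "psd S A"
  shows "psd S (\<lambda>p q. A p q - deflate S v A p q)"
proof (rule psdI)
  show "0 \<le> Re (sesq S (\<lambda>p q. A p q - deflate S v A p q) y y)" for y
    unfolding sesq_diff using Re_sesq_deflate[of S v A y] psd_nonneg[OF assms, of v] by simp
qed (simp flip: psd_herm[OF assms] psd_herm[OF psd_deflate[OF assms]])

lemma deflate_kills:
  assumes "psd S A" "Re (sesq S A v v) \<noteq> 0" "p \<in> S"
  shows "(\<Sum>q\<in>S. cnj (v q) * deflate S v A p q) = 0"
proof -
  define w where "w p = (\<Sum>r\<in>S. cnj (v r) * A p r)" for p
  have s: "(\<Sum>q\<in>S. v q * w q) = sesq S A v v"
    by (simp add: sesq_def w_def sum_distrib_left mult.assoc)
  have wp: "w p = (\<Sum>q\<in>S. A p q * cnj (v q))" by (simp add: w_def mult.commute)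
  have "(\<Sum>q\<in>S. cnj (v q) * deflate S v A p q) =
      w p - w p * cnj (\<Sum>q\<in>S. v q * w q) / of_real (Re (sesq S A v v))"
    unfolding deflate_def w_def[symmetric]
    by (simp add: wp right_diff_distrib sum_subtractf sum_distrib_left sum_divide_distrib mult_ac)
  also have "cnj (\<Sum>q\<in>S. v q * w q) = of_real (Re (sesq S A v v))"
    unfolding s using sesq_self_real[OF assms(1), of v] by (metis complex_cnj_complex_of_real)
  finally show ?thesis using assms(2) by simp
qed

text \<open>The deflated form at \<open>y\<close> is the minimum over \<open>c\<close> of the
  original form at \<open>y + c v\<close>, and a minimum is monotone in the form. The minimiser for
  \<open>A'\<close> is inserted into the form of \<open>A\<close>, whose deflation does not see the
  shift by \<open>c v\<close>.\<close>

lemma psd_deflate_mono: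
  assumes A: "psd S A" and A': "psd S A'" and le: "psd S (\<lambda>p q. A' p q - A p q)"
    and b: "Re (sesq S A v v) > 0"
  shows "psd S (\<lambda>p q. deflate S v A' p q - deflate S v A p q)"
proof (rule psdI)
  fix y
  have le': "Re (sesq S A z z) \<le> Re (sesq S A' z z)" for z
    using psd_nonneg[OF le, of z] by (simp add: sesq_diff)
  have b': "Re (sesq S A' v v) > 0" using b le'[of v] by simp
  define s where "s = sesq S A' y v"
  define b0 where "b0 = Re (sesq S A' v v)"
  \<comment> \<open>Minimiser of the form of \<open>A'\<close> along the line
    \<open>y + c v\<close>.\<close>
  define c where "c = - s / of_real b0"
  let ?z = "\<lambda>p. y p + c * v p"
  have "sesq S (deflate S v A) v z = 0" for z
    using b sesq_self_real[OF A, of v] sesq_cnj[OF A, of v z] unfolding sesq_deflate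
    by (metis complex_cnj_cnj diff_self less_irrefl mult.commute nonzero_mult_div_cancel_left of_real_eq_0_iff)
  then have "Re (sesq S (deflate S v A) y y) = Re (sesq S (deflate S v A) ?z ?z)"
    unfolding sesq_add_scale[OF psd_deflate[OF A]]
    using sesq_cnj[OF psd_deflate[OF A, of v], of y v] by simp
  also have "\<dots> \<le> Re (sesq S A ?z ?z)"
    using psd_nonneg[OF psd_diff_deflate[OF A]] by (simp add: sesq_diff)
  also have "\<dots> \<le> Re (sesq S A' ?z ?z)" by (rule le')
  also have "\<dots> = Re (sesq S (deflate S v A') y y)"
  proof -
    have "Re (cnj c * s) = - (cmod s)\<^sup>2 / b0"
    proof -
      have "cnj c * s = - (s * cnj s) / of_real b0" by (simp add: c_def)
      then show ?thesis unfolding complex_norm_square[symmetric] by (simp flip: of_real_divide)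
    qed
    moreover have "(cmod c)\<^sup>2 = (cmod s)\<^sup>2 / b0\<^sup>2"
      by (simp add: c_def norm_divide power_divide)
    ultimately show ?thesis
      unfolding sesq_add_scale[OF A'] Re_sesq_deflate using b'
      by (simp add: s_def[symmetric] b0_def[symmetric] field_simps power2_eq_square)
  qed
  finally show "0 \<le> Re (sesq S (\<lambda>p q. deflate S v A' p q - deflate S v A p q) y y)"
    by (simp add: sesq_diff)
qed (simp flip: psd_herm[OF psd_deflate[OF A]] psd_herm[OF psd_deflate[OF A']])

text \<open>Deflating at a single point is the Schur complement there, which makes
  \<open>psd_schur_complement\<close> a special case of \<open>psd_deflate\<close>.\<close>

lemma deflate_indicator:
  assumes "psd S A" "finite S" "x \<in> S" "p \<in> S" "q \<in> S"
  shows "deflate S (\<lambda>r. of_bool (r = x)) A p q = A p q - A p x * A x q / A x x"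
proof -
  have "(\<Sum>r\<in>S. cnj (of_bool (r = x)) * A p r) = A p x" for p
  proof -
    have "(\<Sum>r\<in>S. cnj (of_bool (r = x)) * A p r) = (\<Sum>r\<in>S. if r = x then A p r else 0)"
      by (intro sum.cong) auto
    then show ?thesis using assms by simp
  qed
  then show ?thesis unfolding deflate_def
    using assms psd_herm[OF assms(1,5,3)] psd_diag(2)[OF assms(1-3)] by (simp add: sesq_indicators)
qed

lemma psd_schur_complement:
  assumes "psd S A" "finite S" "x \<in> S"
  shows "psd S (\<lambda>p q. A p q - A p x * A x q / A x x)"
  using psd_deflate[OF assms(1), of "\<lambda>r. of_bool (r = x)"] deflate_indicator[OF assms]
  by (subst psd_cong[where B = "deflate S (\<lambda>r. of_bool (r = x)) A"]) auto

text \<open>Induction on points. The Schur complement of \<open>B\<close> at \<open>x\<close>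
  vanishes in row and column \<open>x\<close>, so its product with \<open>A\<close> lives on
  \<open>S\<close>; the rank-one part of \<open>B\<close> that was split off multiplies
  \<open>A\<close> by a congruence.\<close>

lemma psd_Schur_product:
  assumes "finite S" "psd S A" "psd S B"
  shows "psd S (\<lambda>p q. A p q * B p q)"
  using assms
proof (induction S arbitrary: B rule: finite_induct)
  case empty
  then show ?case by (simp add: psd_def sesq_def)
next
  case (insert x S)
  let ?T = "insert x S"
  have T: "finite ?T" "x \<in> ?T" using insert by auto
  define B' where "B' p q = B p q - B p x * B x q / B x x" for p q
  have B': "psd ?T B'"
    unfolding B'_def by (rule psd_schur_complement[OF insert.prems(2) T])
  have z: "B' x q = 0" "B' q x = 0" if "q \<in> ?T" for q
  proof -
    \<comment> \<open>True also for \<open>B x x = 0\<close>, since division by zero gives zero.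
      Then the entry bound kills the whole row and column.\<close>
    have "B' x x = 0" by (simp add: B'_def)
    then have "cmod (B' x q) ^ 2 \<le> 0" "cmod (B' q x) ^ 2 \<le> 0"
      using psd_entry_bound[OF B' T(1) T(2) that] psd_entry_bound[OF B' T(1) that T(2)] by auto
    then show "B' x q = 0" "B' q x = 0" by auto
  qed
  have "psd S (\<lambda>p q. A p q * B' p q)"
    using insert psd_subset[OF _ subset_insertI T(1)] B' by blast
  moreover have "sesq ?T (\<lambda>p q. A p q * B' p q) y y = sesq S (\<lambda>p q. A p q * B' p q) y y" for y
    unfolding sesq_def using insert.hyps by (simp add: z)
  ultimately have 1: "psd ?T (\<lambda>p q. A p q * B' p q)"
    by (intro psdI) (simp_all add: psd_nonneg flip: psd_herm[OF B'] psd_herm[OF insert.prems(1)])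
  have 2: "psd ?T (\<lambda>p q. of_real (1 / Re (B x x)) * (B p x * cnj (B q x) * A p q))"
    by (intro psd_cmult psd_congruence insert.prems) (use psd_diag(1)[OF insert.prems(2) T] in simp)
  have "A p q * B p q = A p q * B' p q + of_real (1 / Re (B x x)) * (B p x * cnj (B q x) * A p q)"
    if "p \<in> ?T" "q \<in> ?T" for p q
    using psd_herm[OF insert.prems(2) that(2) T(2)] psd_diag(2)[OF insert.prems(2) T]
    by (simp add: B'_def algebra_simps)
  then show ?case using psd_add[OF 1 2] by (subst psd_cong) assumption+
qed

text \<open>Converse of the Schur complement: it extends by zero to \<open>x\<close>, and adding
  back the rank-one kernel built from column \<open>x\<close> recovers \<open>A\<close>.\<close>

lemma psd_insert_schur:
  assumes A: "psd S (\<lambda>p q. A p q - A p x * A x q / A x x)" and S: "finite S"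
    and h: "\<And>p. p \<in> S \<Longrightarrow> A x p = cnj (A p x)" and x: "A x x = of_real a" "0 < a"
    and herm: "\<And>p q. p \<in> S \<Longrightarrow> q \<in> S \<Longrightarrow> A q p = cnj (A p q)"
  shows "psd (insert x S) A"
proof (cases "x \<in> S")
  case True
  have "psd S (\<lambda>p q. of_real (1 / a) * (A p x * cnj (A q x)))"
    by (intro psd_cmult psd_outer) (use x in simp)
  then have "psd S (\<lambda>p q. (A p q - A p x * A x q / A x x) + of_real (1 / a) * (A p x * cnj (A q x)))"
    by (intro psd_add A)
  moreover have "A p q - A p x * A x q / A x x + of_real (1 / a) * (A p x * cnj (A q x)) = A p q"
    if "q \<in> S" for p q
    using x h[OF that] by simp
  ultimately show ?thesis using True by (subst (asm) psd_cong[where B = A]) (auto simp: insert_absorb)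
next
  case False
  show ?thesis
  proof (rule psdI)
    fix y
    define B where "B p q = A p q - A p x * A x q / A x x" for p q
    have 1: "psd (insert x S) B"
    proof (rule psdI)
      have "B x q = 0" "B q x = 0" for q using x by (auto simp: B_def)
      then have "sesq (insert x S) B y y = sesq S B y y" for y
        unfolding sesq_def using False S by simp
      then show "0 \<le> Re (sesq (insert x S) B y y)" for y using psd_nonneg[OF A] by (simp flip: B_def)
    next
      fix p q assume pq: "p \<in> insert x S" "q \<in> insert x S"
      have h': "A q p = cnj (A p q)" "A q x = cnj (A x q)" "A x p = cnj (A p x)"
        using pq x h[of p] h[of q] herm[of p q] by auto
      show "B q p = cnj (B p q)"
        unfolding B_def h' using x by simp
    qed
    have 2: "psd (insert x S) (\<lambda>p q. of_real (1 / a) * (A p x * cnj (A q x)))"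
      by (intro psd_cmult psd_outer) (use x in simp)
    have eq: "A p q = B p q + of_real (1 / a) * (A p x * cnj (A q x))"
      if "q \<in> insert x S" for p q
      using x h that by (auto simp: B_def)
    have "sesq (insert x S) A y y =
        sesq (insert x S) (\<lambda>p q. B p q + of_real (1 / a) * (A p x * cnj (A q x))) y y"
      by (intro sesq_cong eq refl)
    then show "0 \<le> Re (sesq (insert x S) A y y)" using psd_nonneg[OF psd_add[OF 1 2]] by simp
  next
    show "A q p = cnj (A p q)" if "p \<in> insert x S" "q \<in> insert x S" for p q
      using that x h[of p] h[of q] herm[of p q] by auto
  qed
qed

section \<open>A Riccati fixed point and the factorization of vectors\<close>

lemma psd_limit:
  assumes "\<And>n. psd S (F n)" and lim: "\<And>p q. p \<in> S \<Longrightarrow> q \<in> S \<Longrightarrow> (\<lambda>n. F n p q) \<longlonglongrightarrow> L p q"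
  shows "psd S L"
proof (rule psdI)
  fix p q assume pq: "p \<in> S" "q \<in> S"
  have "(\<lambda>n. cnj (F n p q)) \<longlonglongrightarrow> cnj (L p q)" by (intro tendsto_intros lim pq)
  then have "(\<lambda>n. F n q p) \<longlonglongrightarrow> cnj (L p q)" by (simp flip: psd_herm[OF assms(1)] add: pq)
  then show "L q p = cnj (L p q)" using LIMSEQ_unique lim[OF pq(2,1)] by blast
next
  fix y
  have "(\<lambda>n. Re (sesq S (F n) y y)) \<longlonglongrightarrow> Re (sesq S L y y)"
    unfolding sesq_def by (intro tendsto_intros lim)
  then show "0 \<le> Re (sesq S L y y)"
    using psd_nonneg[OF assms(1)] by (intro LIMSEQ_le_const) auto
qed

text \<open>The diagonal entries decrease and are nonnegative, hence converge. The entry bound for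
  the positive differences controls the off-diagonal increments by the diagonal ones, so these
  entries are Cauchy too.\<close>

lemma psd_decreasing_convergent:
  assumes "finite S" and J: "\<And>n. psd S (J n)" and dec: "\<And>n. psd S (\<lambda>p q. J n p q - J (Suc n) p q)"
    and pq: "p \<in> S" "q \<in> S"
  shows "convergent (\<lambda>n. J n p q)"
proof -
  have dec': "psd S (\<lambda>p q. J m p q - J n p q)" if "m \<le> n" for m n
    using that
  proof (induction rule: dec_induct)
    case base
    then show ?case by (simp add: psd_def sesq_def)
  next
    case (step n)
    show ?case using psd_add[OF step.IH dec[of n]] by simp
  qed
  define a where "a n = Re (J n p p) + Re (J n q q)" for n
  have "decseq a"
  proof (rule decseq_SucI)
    fix n show "a (Suc n) \<le> a n"
      using psd_diag(1)[OF dec assms(1) pq(1), of n] psd_diag(1)[OF dec assms(1) pq(2), of n]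
      by (simp add: a_def)
  qed
  moreover have "0 \<le> a n" for n
    using psd_diag(1)[OF J assms(1)] pq by (simp add: a_def)
  ultimately have "Cauchy a"
    using decseq_convergent[of a 0] by (metis LIMSEQ_imp_Cauchy)
  have dist: "dist (J m p q) (J n p q) \<le> dist (a m) (a n)" if "m \<le> n" for m n
  proof -
    define r s where "r = Re (J m p p - J n p p)" and "s = Re (J m q q - J n q q)"
    have rs: "0 \<le> r" "0 \<le> s"
      using psd_diag(1)[OF dec'[OF that] assms(1)] pq by (auto simp: r_def s_def)
    have "(cmod (J m p q - J n p q))\<^sup>2 \<le> r * s"
      using psd_entry_bound[OF dec'[OF that] assms(1) pq] by (simp add: r_def s_def)
    also have "\<dots> \<le> (r + s)\<^sup>2" using rs by (simp add: power2_sum)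
    finally have "cmod (J m p q - J n p q) \<le> r + s" using rs power2_le_imp_le by fastforce
    also have "\<dots> \<le> dist (a m) (a n)" by (simp add: r_def s_def a_def dist_real_def)
    finally show ?thesis by (simp add: dist_norm)
  qed
  have "Cauchy (\<lambda>n. J n p q)"
  proof (rule metric_CauchyI)
    fix e :: real assume "0 < e"
    then obtain M where M: "\<And>m n. m \<ge> M \<Longrightarrow> n \<ge> M \<Longrightarrow> dist (a m) (a n) < e"
      using \<open>Cauchy a\<close> unfolding Cauchy_def by blast
    have "dist (J m p q) (J n p q) < e" if "m \<ge> M" "n \<ge> M" for m n
      using dist[of m n] dist[of n m] M[OF that] by (cases "m \<le> n") (auto simp: dist_commute)
    then show "\<exists>M. \<forall>m\<ge>M. \<forall>n\<ge>M. dist (J m p q) (J n p q) < e" by blast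
  qed
  then show ?thesis by (simp add: Cauchy_convergent_iff)
qed

text \<open>\<open>KEB\<close> makes \<open>K\<close> a fixed point of
  \<open>J \<mapsto> E + B J\<close>, so the first step from \<open>K\<close> only deflates and is a
  decrease. Schur products and deflation are monotone, so every later step decreases as
  well.\<close>

lemma riccati_fixpoint:
  assumes I: "finite I" and E: "psd I E" and B: "psd I B" and K: "psd I K"
    and KEB: "\<And>p q. p \<in> I \<Longrightarrow> q \<in> I \<Longrightarrow> K p q = E p q + B p q * K p q"
    and v: "0 < Re (sesq I E v v)"
  obtains J where "psd I J"
    "\<forall>p\<in>I. \<forall>q\<in>I. J p q = deflate I v (\<lambda>p q. E p q + B p q * J p q) p q"
proof -
  define H where "H J = (\<lambda>p q. E p q + B p q * J p q)" for J
  define R where "R J = deflate I v (H J)" for J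
  define J where "J n = (R ^^ n) K" for n
  have H: "psd I (H J)" if "psd I J" for J
    unfolding H_def by (intro psd_add E psd_Schur_product I B that)
  have Hv: "0 < Re (sesq I (H J) v v)" if "psd I J" for J
    using psd_nonneg[OF psd_Schur_product[OF I B that], of v] v by (simp add: H_def sesq_add)
  have R: "psd I (R J)" if "psd I J" for J
    unfolding R_def by (intro psd_deflate H that)
  have J: "psd I (J n)" for n
    by (induction n) (simp_all add: J_def K R)
  have dec: "psd I (\<lambda>p q. J n p q - J (Suc n) p q)" for n
  proof (induction n)
    case 0
    have "psd I (\<lambda>p q. H K p q - R K p q)"
      unfolding R_def by (intro psd_diff_deflate H K)
    moreover have "H K p q - R K p q = J 0 p q - J (Suc 0) p q" if "p \<in> I" "q \<in> I" for p q
      using KEB[OF that] by (simp add: H_def J_def)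
    ultimately show ?case by (subst (asm) psd_cong) assumption+
  next
    case (Suc n)
    have "psd I (\<lambda>p q. H (J n) p q - H (J (Suc n)) p q)"
      using psd_Schur_product[OF I B Suc.IH] by (simp add: H_def algebra_simps)
    then have "psd I (\<lambda>p q. R (J n) p q - R (J (Suc n)) p q)"
      unfolding R_def by (intro psd_deflate_mono H Hv J)
    then show ?case by (simp add: J_def)
  qed
  define L where "L p q = lim (\<lambda>n. J n p q)" for p q
  have lim: "(\<lambda>n. J n p q) \<longlonglongrightarrow> L p q" if "p \<in> I" "q \<in> I" for p q
    using psd_decreasing_convergent[where J = J, OF I J dec that] by (simp add: L_def convergent_LIMSEQ_iff)
  have L: "psd I L" by (rule psd_limit[OF J lim])
  show ?thesis
  proof (rule that[OF L], intro ballI)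
    fix p q assume pq: "p \<in> I" "q \<in> I"
    \<comment> \<open>The form of \<open>E\<close> at \<open>v\<close> bounds all denominators away
      from zero, so the iteration map is continuous at the limit.\<close>
    have "complex_of_real (Re (sesq I (H L) v v)) \<noteq> 0" using Hv[OF L] by simp
    then have "(\<lambda>n. R (J n) p q) \<longlonglongrightarrow> R L p q"
      unfolding R_def deflate_def sesq_def H_def
      by (intro tendsto_intros lim pq) assumption
    moreover have "(\<lambda>n. R (J n) p q) \<longlonglongrightarrow> L p q"
      using LIMSEQ_Suc[OF lim[OF pq]] by (simp add: J_def)
    ultimately have "L p q = R L p q" by (metis LIMSEQ_unique)
    then show "L p q = deflate I v (\<lambda>p q. E p q + B p q * L p q) p q"
      by (simp add: R_def H_def)
  qed
qed

lemma sesq_identity: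
  assumes "finite T"
  shows "sesq T (\<lambda>i j. of_bool (i = j)) y v = (\<Sum>i\<in>T. y i * cnj (v i))"
proof -
  have "(\<Sum>j\<in>T. y i * cnj (v j) * of_bool (i = j)) = y i * cnj (v i)" if "i \<in> T" for i
  proof -
    have "(\<Sum>j\<in>T. y i * cnj (v j) * of_bool (i = j)) = (\<Sum>j\<in>T. if i = j then y i * cnj (v j) else 0)"
      by (intro sum.cong) auto
    then show ?thesis using assms that by simp
  qed
  then show ?thesis unfolding sesq_def by simp
qed

lemma psd_identity:
  assumes "finite T"
  shows "psd T (\<lambda>i j. of_bool (i = j))"
proof (rule psdI)
  show "0 \<le> Re (sesq T (\<lambda>i j. of_bool (i = j)) y y)" for y
    unfolding sesq_identity[OF assms] Re_sum complex_norm_square[symmetric]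
    by (intro sum_nonneg) simp
qed auto

text \<open>\<open>E\<close> is the constant kernel \<open>1\<close> tensored with the identity
  matrix, and its form at the conjugate of \<open>x\<close> is the sum over \<open>i\<close> of the
  squared moduli of \<open>\<Sum>z\<in>Y. x (z, i)\<close>; the last assumption makes it positive.
  For a kernel normalized at a base point these sums are the values there of the functions with
  kernel coefficients \<open>x\<close>.\<close>

lemma column_fixpoint:
  fixes Y :: "'x set" and K B :: "'x \<Rightarrow> 'x \<Rightarrow> complex" and x :: "'x \<times> nat \<Rightarrow> complex" and N :: nat
  defines "I \<equiv> Y \<times> {..<N}"
  assumes Y: "finite Y" and K: "psd Y K" and B: "psd Y B"
    and KB: "\<And>z w. z \<in> Y \<Longrightarrow> w \<in> Y \<Longrightarrow> K z w * (1 - B z w) = 1"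
    and x: "j < N" "(\<Sum>z\<in>Y. x (z, j)) \<noteq> 0"
  obtains \<Theta> where
    "psd I (\<lambda>p q. K (fst p) (fst q) * (of_bool (snd p = snd q) - \<Theta> p * cnj (\<Theta> q)))"
    "\<forall>p\<in>I. (\<Sum>q\<in>I. x q * (K (fst p) (fst q) * (of_bool (snd p = snd q) - \<Theta> p * cnj (\<Theta> q)))) = 0"
proof -
  define E where "E p q = (of_bool (snd p = snd q) :: complex)" for p q :: "'x \<times> nat"
  define B' where "B' p q = B (fst p) (fst q)" for p q :: "'x \<times> nat"
  define K' where "K' p q = E p q * K (fst p) (fst q)" for p q :: "'x \<times> nat"
  \<comment> \<open>Conjugated because forms conjugate their second argument: annihilating
    \<open>v\<close> then gives the sum with coefficients \<open>x\<close> in the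
    conclusion.\<close>
  define v where "v p = cnj (x p)" for p
  have I: "finite I" using Y by (simp add: I_def)
  have fst: "fst ` I \<subseteq> Y" and snd: "snd ` I \<subseteq> {..<N}" by (auto simp: I_def)
  have E: "psd I E"
    unfolding E_def by (rule psd_pullback[OF psd_identity I _ snd]) auto
  have B': "psd I B'" unfolding B'_def by (rule psd_pullback[OF B I Y fst])
  have K': "psd I K'"
    unfolding K'_def by (intro psd_Schur_product I E psd_pullback[OF K I Y fst])
  have KB': "K (fst p) (fst q) * (1 - B' p q) = 1" if "p \<in> I" "q \<in> I" for p q
    using KB[of "fst p" "fst q"] that by (auto simp: I_def B'_def)
  have KEB: "K' p q = E p q + B' p q * K' p q" if "p \<in> I" "q \<in> I" for p q
    using arg_cong[OF KB'[OF that], of "\<lambda>c. E p q * c"] by (simp add: K'_def algebra_simps)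
  have v: "0 < Re (sesq I E v v)"
  proof -
    define s where "s i = (\<Sum>p\<in>{p\<in>I. snd p = i}. v p)" for i
    have s: "s j = cnj (\<Sum>z\<in>Y. x (z, j))"
    proof -
      have "{p\<in>I. snd p = j} = (\<lambda>z. (z, j)) ` Y" using x(1) by (auto simp: I_def)
      then show ?thesis unfolding s_def v_def by (simp add: sum.reindex inj_on_def)
    qed
    have "Re (sesq I E v v) = (\<Sum>i<N. (cmod (s i))\<^sup>2)"
      unfolding E_def sesq_pullback[OF I finite_lessThan snd, of "\<lambda>i j. of_bool (i = j)"]
        sesq_identity[OF finite_lessThan] s_def[symmetric] complex_norm_square[symmetric] by simp
    also have "\<dots> \<ge> (cmod (s j))\<^sup>2"
      using x(1) by (intro member_le_sum) auto
    finally show ?thesis using x(2) s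
      by (metis complex_cnj_zero_iff less_le_trans zero_less_norm_iff zero_less_power)
  qed
  obtain J where J: "psd I J"
    and Jeq': "\<forall>p\<in>I. \<forall>q\<in>I. J p q = deflate I v (\<lambda>p q. E p q + B' p q * J p q) p q"
    by (rule riccati_fixpoint[OF I E B' K' KEB v]) blast+
  define H where "H = (\<lambda>p q. E p q + B' p q * J p q)"
  have Jeq: "J p q = deflate I v H p q" if "p \<in> I" "q \<in> I" for p q
    using Jeq' that by (simp add: H_def)
  have H: "psd I H" unfolding H_def by (intro psd_add E psd_Schur_product I B' J)
  define b where "b = Re (sesq I H v v)"
  have b: "0 < b"
    using psd_nonneg[OF psd_Schur_product[OF I B' J], of v] v by (simp add: b_def H_def sesq_add)
  \<comment> \<open>The rank-one kernel removed by deflation is divided by \<open>b\<close>; the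
    square root splits this evenly between the two factors.\<close>
  define \<Theta> where "\<Theta> p = (\<Sum>r\<in>I. cnj (v r) * H p r) / of_real (sqrt b)" for p
  have J\<Theta>: "J p q = K (fst p) (fst q) * (of_bool (snd p = snd q) - \<Theta> p * cnj (\<Theta> q))"
    if "p \<in> I" "q \<in> I" for p q
  proof -
    have "complex_of_real (sqrt b) * of_real (sqrt b) = of_real b"
      using b by (simp flip: of_real_mult)
    then have "J p q = H p q - \<Theta> p * cnj (\<Theta> q)"
      unfolding Jeq[OF that] deflate_def b_def[symmetric]
      by (simp add: \<Theta>_def)
    then have "(1 - B' p q) * J p q = E p q - \<Theta> p * cnj (\<Theta> q)"
      by (simp add: H_def algebra_simps)
    moreover have "J p q = K (fst p) (fst q) * ((1 - B' p q) * J p q)"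
      using KB'[OF that] by (simp flip: mult.assoc)
    ultimately show ?thesis by (simp add: E_def)
  qed
  show ?thesis
  proof (rule that)
    show "psd I (\<lambda>p q. K (fst p) (fst q) * (of_bool (snd p = snd q) - \<Theta> p * cnj (\<Theta> q)))"
      using J by (subst (asm) psd_cong[OF J\<Theta>])
    show "\<forall>p\<in>I. (\<Sum>q\<in>I. x q * (K (fst p) (fst q) * (of_bool (snd p = snd q) - \<Theta> p * cnj (\<Theta> q)))) = 0"
    proof
      fix p assume p: "p \<in> I"
      have "(\<Sum>q\<in>I. x q * (K (fst p) (fst q) * (of_bool (snd p = snd q) - \<Theta> p * cnj (\<Theta> q)))) =
          (\<Sum>q\<in>I. cnj (v q) * deflate I v H p q)"
        by (intro sum.cong refl) (simp add: v_def flip: J\<Theta>[OF p] Jeq[OF p])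
      also have "\<dots> = 0" by (rule deflate_kills[OF H _ p]) (use b b_def in simp)
      finally show "(\<Sum>q\<in>I. x q * (K (fst p) (fst q) * (of_bool (snd p = snd q) - \<Theta> p * cnj (\<Theta> q)))) = 0" .
    qed
  qed
qed

lemma sum_times:
  "(\<Sum>p\<in>S \<times> T. f p) = (\<Sum>z\<in>S. \<Sum>i\<in>T. f (z, i))"
  by (simp add: sum.cartesian_product)

text \<open>
  Here \<open>c\<close> is the squared norm of the factored vector, and the last conclusion says that \<open>h\<close> is the
  restriction to \<open>Y\<close> of a function of norm at most \<open>sqrt c\<close>.
\<close>

lemma vector_factorization:
  fixes Y :: "'x set" and K B :: "'x \<Rightarrow> 'x \<Rightarrow> complex" and x :: "'x \<times> nat \<Rightarrow> complex" and N :: nat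
  defines "c \<equiv> (\<Sum>i<N. Re (sesq Y K (\<lambda>z. cnj (x (z, i))) (\<lambda>z. cnj (x (z, i)))))"
  assumes Y: "finite Y" and K: "psd Y K" and B: "psd Y B"
    and KB: "\<And>z w. z \<in> Y \<Longrightarrow> w \<in> Y \<Longrightarrow> K z w * (1 - B z w) = 1"
    and x: "j < N" "(\<Sum>z\<in>Y. x (z, j)) \<noteq> 0"
  obtains \<Theta> h where
    "psd (Y \<times> {..<N}) (\<lambda>p q. K (fst p) (fst q) * (of_bool (snd p = snd q) - \<Theta> p * cnj (\<Theta> q)))"
    "\<And>z i. z \<in> Y \<Longrightarrow> i < N \<Longrightarrow> (\<Sum>w\<in>Y. x (w, i) * K z w) = \<Theta> (z, i) * h z"
    "psd Y (\<lambda>z w. of_real c * K z w - h z * cnj (h w))"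
proof -
  let ?I = "Y \<times> {..<N}"
  obtain \<Theta> where \<Theta>: "psd ?I (\<lambda>p q. K (fst p) (fst q) * (of_bool (snd p = snd q) - \<Theta> p * cnj (\<Theta> q)))"
    and \<Theta>x: "\<forall>p\<in>?I. (\<Sum>q\<in>?I. x q * (K (fst p) (fst q) * (of_bool (snd p = snd q) - \<Theta> p * cnj (\<Theta> q)))) = 0"
    by (rule column_fixpoint[OF Y K B KB x]) blast+
  \<comment> \<open>\<open>h\<close> is the adjoint of multiplication by \<open>\<Theta>\<close>
    applied to the vector \<open>F\<close> with coefficients \<open>x\<close>. That the kernel of
    the limit annihilates \<open>x\<close> says exactly that \<open>F = \<Theta> h\<close>.\<close>
  define t where "t w = (\<Sum>i<N. x (w, i) * cnj (\<Theta> (w, i)))" for w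
  define h where "h z = (\<Sum>w\<in>Y. K z w * t w)" for z
  have fh: "(\<Sum>w\<in>Y. x (w, i) * K z w) = \<Theta> (z, i) * h z" if z: "z \<in> Y" and i: "i < N" for z i
  proof -
    have "0 = (\<Sum>w\<in>Y. \<Sum>k<N. x (w, k) * (K z w * (of_bool (i = k) - \<Theta> (z, i) * cnj (\<Theta> (w, k)))))"
      using \<Theta>x[rule_format, of "(z, i)"] z i by (simp add: sum_times)
    also have "\<dots> = (\<Sum>w\<in>Y. (\<Sum>k<N. of_bool (i = k) * (x (w, k) * K z w)) - \<Theta> (z, i) * (K z w * t w))"
      by (intro sum.cong refl) (simp add: t_def sum_subtractf algebra_simps sum_distrib_left)
    also have "\<dots> = (\<Sum>w\<in>Y. x (w, i) * K z w - \<Theta> (z, i) * (K z w * t w))"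
    proof (intro sum.cong refl)
      fix w
      have "(\<Sum>k<N. of_bool (i = k) * (x (w, k) * K z w)) = (\<Sum>k<N. if i = k then x (w, k) * K z w else 0)"
        by (intro sum.cong) auto
      then show "(\<Sum>k<N. of_bool (i = k) * (x (w, k) * K z w)) - \<Theta> (z, i) * (K z w * t w) =
          x (w, i) * K z w - \<Theta> (z, i) * (K z w * t w)" using i by simp
    qed
    finally show ?thesis by (simp add: sum_subtractf h_def sum_distrib_left)
  qed
  have sh: "(\<Sum>z\<in>Y. y z * h z) = sesq Y K y (\<lambda>w. cnj (t w))" for y
    by (simp add: sesq_def h_def sum_distrib_left mult_ac)
  \<comment> \<open>The norms of \<open>F\<close> and \<open>h\<close> agree: pairing
    \<open>F = \<Theta> h\<close> with \<open>F\<close> and moving \<open>\<Theta>\<close> to the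
    other side gives the pairing of \<open>h\<close> with itself.\<close>
  have c: "c = Re (sesq Y K (\<lambda>w. cnj (t w)) (\<lambda>w. cnj (t w)))"
  proof -
    have "(\<Sum>i<N. sesq Y K (\<lambda>z. cnj (x (z, i))) (\<lambda>z. cnj (x (z, i)))) =
        (\<Sum>i<N. \<Sum>z\<in>Y. cnj (x (z, i)) * (\<Sum>w\<in>Y. x (w, i) * K z w))"
      by (simp add: sesq_def sum_distrib_left mult_ac)
    also have "\<dots> = (\<Sum>i<N. \<Sum>z\<in>Y. cnj (x (z, i)) * (\<Theta> (z, i) * h z))"
      by (intro sum.cong refl) (simp add: fh)
    also have "\<dots> = (\<Sum>z\<in>Y. cnj (t z) * h z)"
      by (subst sum.swap) (simp add: t_def sum_distrib_right sum_distrib_left mult_ac)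
    also have "\<dots> = sesq Y K (\<lambda>w. cnj (t w)) (\<lambda>w. cnj (t w))" by (rule sh)
    finally show ?thesis unfolding c_def by (metis Re_sum)
  qed
  have "psd Y (\<lambda>z w. of_real c * K z w - h z * cnj (h w))"
  proof (rule psd_outer_diff)
    show "psd Y (\<lambda>z w. of_real c * K z w)"
      using c psd_nonneg[OF K] by (intro psd_cmult K) simp
    show "(cmod (\<Sum>p\<in>Y. y p * h p))\<^sup>2 \<le> Re (sesq Y (\<lambda>z w. of_real c * K z w) y y)" for y
      unfolding sh sesq_cmult using psd_Cauchy_Schwarz[OF K, of y "\<lambda>w. cnj (t w)"]
      by (simp add: c mult_ac)
  qed
  then show ?thesis using that \<Theta> fh by blast
qed

section \<open>From stacked columns to matrices\<close>

text \<open>Compression of a matrix-valued kernel by a row \<open>\<theta>\<close>. It lets the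
  transpose of \<open>\<Theta>\<close> act on the inequality for the stacked column.\<close>

lemma psd_contract:
  assumes "psd (S \<times> T) A"
  shows "psd S (\<lambda>p q. \<Sum>j\<in>T. \<Sum>k\<in>T. \<theta> p j * cnj (\<theta> q k) * A (p, j) (q, k))"
proof (rule psdI)
  fix p q assume "p \<in> S" "q \<in> S"
  then have "cnj (\<Sum>j\<in>T. \<Sum>k\<in>T. \<theta> p j * cnj (\<theta> q k) * A (p, j) (q, k)) =
      (\<Sum>j\<in>T. \<Sum>k\<in>T. \<theta> q k * cnj (\<theta> p j) * A (q, k) (p, j))"
    unfolding cnj_sum by (intro sum.cong refl) (simp add: psd_herm[OF assms, of "(p, _)" "(q, _)"])
  also have "\<dots> = (\<Sum>k\<in>T. \<Sum>j\<in>T. \<theta> q k * cnj (\<theta> p j) * A (q, k) (p, j))"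
    by (rule sum.swap)
  finally show "(\<Sum>k\<in>T. \<Sum>j\<in>T. \<theta> q k * cnj (\<theta> p j) * A (q, k) (p, j)) =
      cnj (\<Sum>j\<in>T. \<Sum>k\<in>T. \<theta> p j * cnj (\<theta> q k) * A (p, j) (q, k))" ..
next
  fix y :: "'a \<Rightarrow> complex"
  have "sesq S (\<lambda>p q. \<Sum>j\<in>T. \<Sum>k\<in>T. \<theta> p j * cnj (\<theta> q k) * A (p, j) (q, k)) y y =
      (\<Sum>p\<in>S. \<Sum>q\<in>S. \<Sum>j\<in>T. \<Sum>k\<in>T. (y p * \<theta> p j) * cnj (y q * \<theta> q k) * A (p, j) (q, k))"
    by (simp add: sesq_def sum_distrib_left mult_ac)
  also have "\<dots> = (\<Sum>p\<in>S. \<Sum>j\<in>T. \<Sum>q\<in>S. \<Sum>k\<in>T. (y p * \<theta> p j) * cnj (y q * \<theta> q k) * A (p, j) (q, k))"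
    by (intro sum.cong refl sum.swap)
  also have "\<dots> = sesq (S \<times> T) A (\<lambda>(p, j). y p * \<theta> p j) (\<lambda>(p, j). y p * \<theta> p j)"
    by (simp add: sesq_def sum_times)
  finally show "0 \<le> Re (sesq S (\<lambda>p q. \<Sum>j\<in>T. \<Sum>k\<in>T. \<theta> p j * cnj (\<theta> q k) * A (p, j) (q, k)) y y)"
    using psd_nonneg[OF assms] by simp
qed

lemma psd_Cauchy_outer_diff:
  assumes "psd S (\<lambda>p q. A p q - u p * cnj (u q))"
  shows "(cmod (\<Sum>p\<in>S. y p * u p))\<^sup>2 \<le> Re (sesq S A y y)"
  using psd_nonneg[OF assms, of y] unfolding sesq_diff sesq_outer complex_norm_square[symmetric]
  by simp

lemma sesq_sum: "sesq S (\<lambda>p q. \<Sum>j\<in>T. A j p q) y v = (\<Sum>j\<in>T. sesq S (A j) y v)"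
proof (induction T rule: infinite_finite_induct)
  case (insert j T)
  then show ?case by (simp add: sesq_add)
qed (simp_all add: sesq_def)

lemma sum_of_bool_mult:
  fixes f :: "'a \<Rightarrow> complex"
  assumes "finite T" "j \<in> T"
  shows "(\<Sum>k\<in>T. of_bool (j = k) * f k) = f j"
proof -
  have "(\<Sum>k\<in>T. of_bool (j = k) * f k) = (\<Sum>k\<in>T. if j = k then f k else 0)"
    by (intro sum.cong) auto
  then show ?thesis using assms by simp
qed

text \<open>Write the vector as \<open>\<Theta> h\<close>; then \<open>\<phi>\<close> maps it to
  \<open>h g\<close>, where \<open>g\<close> is the transpose of \<open>\<Theta>\<close> applied to
  the stacked entries. Three inequalities combine: \<open>\<Theta>\<close> is a contractive row, the
  stacked column is contractive into the space of \<open>K P\<close>, and \<open>h\<close> has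
  squared norm at most \<open>c\<close>. The factor \<open>P\<close> is \<open>1\<close> for the
  theorem and \<open>L / K\<close> in the induction on points.\<close>

lemma matrix_vector_bound:
  fixes Y :: "'x set" and K B P :: "'x \<Rightarrow> 'x \<Rightarrow> complex" and M N :: nat
    and x :: "'x \<times> nat \<Rightarrow> complex" and \<phi> :: "('x \<times> nat) \<times> nat \<Rightarrow> complex"
  defines "c \<equiv> (\<Sum>j<N. Re (sesq Y K (\<lambda>z. cnj (x (z, j))) (\<lambda>z. cnj (x (z, j)))))"
  assumes Y: "finite Y" and K: "psd Y K" and B: "psd Y B" and P: "psd Y P"
    and KB: "\<And>z w. z \<in> Y \<Longrightarrow> w \<in> Y \<Longrightarrow> K z w * (1 - B z w) = 1"
    and row: "\<And>\<Theta>. psd (Y \<times> {..<N}) (\<lambda>p q. K (fst p) (fst q) * (of_bool (snd p = snd q) - \<Theta> p * cnj (\<Theta> q)))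
      \<Longrightarrow> psd Y (\<lambda>z w. K z w * (1 - (\<Sum>j<N. \<Theta> (z, j) * cnj (\<Theta> (w, j)))))"
    and stacked: "psd ((Y \<times> {..<M}) \<times> {..<N}) (\<lambda>p q. of_bool (snd (fst p) = snd (fst q)) * of_bool (snd p = snd q) *
      (K (fst (fst p)) (fst (fst q)) * P (fst (fst p)) (fst (fst q))) - K (fst (fst p)) (fst (fst q)) * (\<phi> p * cnj (\<phi> q)))"
    and x: "j < N" "(\<Sum>z\<in>Y. x (z, j)) \<noteq> 0"
  shows "(cmod (\<Sum>p\<in>Y \<times> {..<M}. \<xi> p * (\<Sum>j<N. \<phi> (p, j) * (\<Sum>w\<in>Y. x (w, j) * K (fst p) w))))\<^sup>2
    \<le> c * Re (sesq (Y \<times> {..<M}) (\<lambda>p q. of_bool (snd p = snd q) * (K (fst p) (fst q) * P (fst p) (fst q))) \<xi> \<xi>)"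
proof -
  let ?I = "Y \<times> {..<M}"
  obtain \<Theta> h where \<Theta>: "psd (Y \<times> {..<N}) (\<lambda>p q. K (fst p) (fst q) * (of_bool (snd p = snd q) - \<Theta> p * cnj (\<Theta> q)))"
    and f: "\<And>z i. z \<in> Y \<Longrightarrow> i < N \<Longrightarrow> (\<Sum>w\<in>Y. x (w, i) * K z w) = \<Theta> (z, i) * h z"
    and h: "psd Y (\<lambda>z w. of_real c * K z w - h z * cnj (h w))"
    unfolding c_def by (rule vector_factorization[OF Y K B KB x]) blast+
  have I: "finite ?I" "fst ` ?I \<subseteq> Y" "snd ` ?I \<subseteq> {..<M}" using Y by auto
  have c: "0 \<le> c" unfolding c_def by (intro sum_nonneg psd_nonneg K)
  define g where "g p = (\<Sum>j<N. \<Theta> (fst p, j) * \<phi> (p, j))" for p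
  define s where "s z w = (\<Sum>j<N. \<Theta> (z, j) * cnj (\<Theta> (w, j)))" for z w
  have k0: "psd Y (\<lambda>z w. K z w * (1 - s z w))" unfolding s_def by (rule row[OF \<Theta>])
  have k1: "psd ?I (\<lambda>p q. of_real c * (of_bool (snd p = snd q) *
      (P (fst p) (fst q) * (K (fst p) (fst q) * (1 - s (fst p) (fst q))))))"
    by (intro psd_cmult[OF _ c] psd_Schur_product[OF I(1) psd_pullback[OF psd_identity I(1) _ I(3)]]
        psd_Schur_product[OF I(1) psd_pullback[OF P I(1) Y I(2)] psd_pullback[OF k0 I(1) Y I(2)]]) auto
  have k2: "psd ?I (\<lambda>p q. of_real c * (of_bool (snd p = snd q) * (K (fst p) (fst q) * P (fst p) (fst q)) * s (fst p) (fst q)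
      - K (fst p) (fst q) * (g p * cnj (g q))))"
  proof (intro psd_cmult[OF _ c])
    have "(\<Sum>j<N. \<Sum>k<N. \<Theta> (fst p, j) * cnj (\<Theta> (fst q, k)) *
        (of_bool (snd p = snd q) * of_bool (j = k) * (K (fst p) (fst q) * P (fst p) (fst q))
          - K (fst p) (fst q) * (\<phi> (p, j) * cnj (\<phi> (q, k))))) =
        of_bool (snd p = snd q) * (K (fst p) (fst q) * P (fst p) (fst q)) * s (fst p) (fst q)
        - K (fst p) (fst q) * (g p * cnj (g q))" for p q :: "'x \<times> nat"
    proof -
      have 1: "(\<Sum>j<N. \<Sum>k<N. \<Theta> (fst p, j) * cnj (\<Theta> (fst q, k)) * (\<phi> (p, j) * cnj (\<phi> (q, k)))) = g p * cnj (g q)"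
        unfolding g_def cnj_sum sum_product by (simp add: mult_ac)
      have 2: "(\<Sum>j<N. \<Sum>k<N. of_bool (j = k) * (\<Theta> (fst p, j) * cnj (\<Theta> (fst q, k)))) = s (fst p) (fst q)"
        unfolding s_def by (intro sum.cong refl sum_of_bool_mult) auto
      show ?thesis unfolding 1[symmetric] 2[symmetric] sum_distrib_left sum_subtractf[symmetric]
        by (intro sum.cong refl) (simp add: algebra_simps)
    qed
    then show "psd ?I (\<lambda>p q. of_bool (snd p = snd q) * (K (fst p) (fst q) * P (fst p) (fst q)) * s (fst p) (fst q)
      - K (fst p) (fst q) * (g p * cnj (g q)))"
      using psd_contract[OF stacked, of "\<lambda>p j. \<Theta> (fst p, j)"] by simp
  qed
  have k3: "psd ?I (\<lambda>p q. g p * cnj (g q) * (of_real c * K (fst p) (fst q) - h (fst p) * cnj (h (fst q))))"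
    by (intro psd_congruence psd_pullback[OF h I(1) Y I(2)])
  define u where "u p = (\<Sum>j<N. \<phi> (p, j) * (\<Sum>w\<in>Y. x (w, j) * K (fst p) w))" for p
  have u: "u p = h (fst p) * g p" if "p \<in> ?I" for p
  proof -
    have "\<phi> (p, j) * (\<Sum>w\<in>Y. x (w, j) * K (fst p) w) = h (fst p) * (\<Theta> (fst p, j) * \<phi> (p, j))" if "j < N" for j
      using f[of "fst p" j] \<open>p \<in> ?I\<close> that by auto
    then show ?thesis unfolding u_def g_def sum_distrib_left[of "h _"] by (intro sum.cong refl) auto
  qed
  \<comment> \<open>The sum of \<open>k1\<close>, \<open>k2\<close> and \<open>k3\<close>
    telescopes: the terms with \<open>s\<close> cancel, then those with \<open>c K\<close> and the
    outer product of \<open>g\<close>.\<close>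
  have "psd ?I (\<lambda>p q. of_real c * (of_bool (snd p = snd q) * (K (fst p) (fst q) * P (fst p) (fst q))) - u p * cnj (u q))"
  proof (subst psd_cong)
    show "psd ?I (\<lambda>p q. of_real c * (of_bool (snd p = snd q) *
          (P (fst p) (fst q) * (K (fst p) (fst q) * (1 - s (fst p) (fst q)))))
        + (of_real c * (of_bool (snd p = snd q) * (K (fst p) (fst q) * P (fst p) (fst q)) * s (fst p) (fst q)
          - K (fst p) (fst q) * (g p * cnj (g q)))
        + g p * cnj (g q) * (of_real c * K (fst p) (fst q) - h (fst p) * cnj (h (fst q)))))"
      by (intro psd_add k1 k2 k3)
  qed (simp add: u algebra_simps)
  from psd_Cauchy_outer_diff[OF this, of \<xi>] show ?thesis
    unfolding sesq_cmult u_def by simp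
qed

text \<open>Duality with the previous bound: it is applied to the vector obtained from
  \<open>\<xi>\<close> by the adjoint of \<open>\<phi>\<close>. There \<open>U x\<close> equals the
  squared norm \<open>c x\<close>, so \<open>c x\<close> squared is at most
  \<open>c x * \<Lambda>\<close>, and one factor cancels.\<close>

lemma psd_matrix_of_stacked:
  fixes Y :: "'x set" and K B P :: "'x \<Rightarrow> 'x \<Rightarrow> complex" and M N :: nat
    and \<phi> :: "('x \<times> nat) \<times> nat \<Rightarrow> complex"
  assumes Y: "finite Y" and K: "psd Y K" and B: "psd Y B" and P: "psd Y P"
    and KB: "\<And>z w. z \<in> Y \<Longrightarrow> w \<in> Y \<Longrightarrow> K z w * (1 - B z w) = 1"
    and row: "\<And>\<Theta>. psd (Y \<times> {..<N}) (\<lambda>p q. K (fst p) (fst q) * (of_bool (snd p = snd q) - \<Theta> p * cnj (\<Theta> q)))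
      \<Longrightarrow> psd Y (\<lambda>z w. K z w * (1 - (\<Sum>j<N. \<Theta> (z, j) * cnj (\<Theta> (w, j)))))"
    and stacked: "psd ((Y \<times> {..<M}) \<times> {..<N}) (\<lambda>p q. of_bool (snd (fst p) = snd (fst q)) * of_bool (snd p = snd q) *
      (K (fst (fst p)) (fst (fst q)) * P (fst (fst p)) (fst (fst q))) - K (fst (fst p)) (fst (fst q)) * (\<phi> p * cnj (\<phi> q)))"
  shows "psd (Y \<times> {..<M}) (\<lambda>p q. of_bool (snd p = snd q) * (K (fst p) (fst q) * P (fst p) (fst q))
    - K (fst p) (fst q) * (\<Sum>j<N. \<phi> (p, j) * cnj (\<phi> (q, j))))"
proof (rule psdI)
  let ?I = "Y \<times> {..<M}"
  show "of_bool (snd q = snd p) * (K (fst q) (fst p) * P (fst q) (fst p))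
      - K (fst q) (fst p) * (\<Sum>j<N. \<phi> (q, j) * cnj (\<phi> (p, j))) =
    cnj (of_bool (snd p = snd q) * (K (fst p) (fst q) * P (fst p) (fst q))
      - K (fst p) (fst q) * (\<Sum>j<N. \<phi> (p, j) * cnj (\<phi> (q, j))))"
    if "p \<in> ?I" "q \<in> ?I" for p q
    using that psd_herm[OF K, of "fst p" "fst q"] psd_herm[OF P, of "fst p" "fst q"]
    by (auto simp: mult.commute)
next
  let ?I = "Y \<times> {..<M}"
  have I: "finite ?I" "fst ` ?I \<subseteq> Y" "snd ` ?I \<subseteq> {..<M}" using Y by auto
  fix \<xi>
  define c where "c x = (\<Sum>j<N. Re (sesq Y K (\<lambda>z. cnj (x (z, j))) (\<lambda>z. cnj (x (z, j)))))" for x :: "'x \<times> nat \<Rightarrow> complex"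
  define \<Lambda> where "\<Lambda> = Re (sesq ?I (\<lambda>p q. of_bool (snd p = snd q) * (K (fst p) (fst q) * P (fst p) (fst q))) \<xi> \<xi>)"
  define U where "U x = (\<Sum>p\<in>?I. \<xi> p * (\<Sum>j<N. \<phi> (p, j) * (\<Sum>w\<in>Y. x (w, j) * K (fst p) w)))" for x
  have bound: "(cmod (U x))\<^sup>2 \<le> c x * \<Lambda>" if "0 < N" "Y \<noteq> {}" for x
  proof (cases "(\<Sum>z\<in>Y. x (z, 0)) = 0")
    case False
    show ?thesis unfolding U_def c_def \<Lambda>_def
      by (rule matrix_vector_bound[OF Y K B P KB row stacked that(1) False])
  next
    case True
    obtain z0 where z0: "z0 \<in> Y" using \<open>Y \<noteq> {}\<close> by blast
    \<comment> \<open>Adding a small multiple of the kernel function at \<open>z0\<close> to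
      component \<open>0\<close> makes the coefficient sum nonzero; the bound survives the
      limit.\<close>
    define x' where "x' n p = x p + of_bool (p = (z0, 0)) * of_real (inverse (real (Suc n)))" for n p
    have "(\<Sum>z\<in>Y. x' n (z, 0)) = of_real (inverse (real (Suc n)))" for n
    proof -
      have "(\<Sum>z\<in>Y. x' n (z, 0)) =
          (\<Sum>z\<in>Y. of_bool (z0 = z) * complex_of_real (inverse (real (Suc n))))"
        by (simp add: x'_def sum.distrib True eq_commute)
      also have "\<dots> = of_real (inverse (real (Suc n)))"
        by (rule sum_of_bool_mult[OF Y z0])
      finally show ?thesis .
    qed
    moreover have "complex_of_real (inverse (real (Suc n))) \<noteq> 0" for n
      unfolding of_real_eq_0_iff by simp
    ultimately have nz: "(\<Sum>z\<in>Y. x' n (z, 0)) \<noteq> 0" for n by metis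
    have "(cmod (U (x' n)))\<^sup>2 \<le> c (x' n) * \<Lambda>" for n
      unfolding U_def c_def \<Lambda>_def
      by (rule matrix_vector_bound[OF Y K B P KB row stacked that(1) nz])
    moreover have lim: "(\<lambda>n. x' n p) \<longlonglongrightarrow> x p" for p
    proof -
      have "(\<lambda>n. x' n p) \<longlonglongrightarrow> x p + of_bool (p = (z0, 0)) * of_real 0"
        unfolding x'_def by (intro tendsto_intros LIMSEQ_inverse_real_of_nat)
      then show ?thesis by simp
    qed
    have "(\<lambda>n. (cmod (U (x' n)))\<^sup>2) \<longlonglongrightarrow> (cmod (U x))\<^sup>2"
      unfolding U_def by (intro tendsto_intros lim)
    moreover have "(\<lambda>n. c (x' n) * \<Lambda>) \<longlonglongrightarrow> c x * \<Lambda>"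
      unfolding c_def sesq_def by (intro tendsto_intros lim)
    ultimately show ?thesis by (intro LIMSEQ_le) auto
  qed
  \<comment> \<open>Coefficients of the adjoint of \<open>\<phi>\<close> applied to the vector
    encoded by \<open>\<xi>\<close>.\<close>
  define x where "x p = (\<Sum>i<M. cnj (\<phi> ((fst p, i), snd p)) * cnj (\<xi> (fst p, i)))" for p
  have Ux: "U x = (\<Sum>j<N. sesq Y K (\<lambda>z. cnj (x (z, j))) (\<lambda>z. cnj (x (z, j))))"
  proof -
    have "U x = (\<Sum>z\<in>Y. \<Sum>i<M. \<Sum>j<N. (\<phi> ((z, i), j) * \<xi> (z, i)) * (\<Sum>w\<in>Y. x (w, j) * K z w))"
      unfolding U_def sum_times sum_distrib_left by (simp add: mult_ac)
    also have "\<dots> = (\<Sum>z\<in>Y. \<Sum>j<N. \<Sum>i<M. (\<phi> ((z, i), j) * \<xi> (z, i)) * (\<Sum>w\<in>Y. x (w, j) * K z w))"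
      by (intro sum.cong refl sum.swap)
    also have "\<dots> = (\<Sum>z\<in>Y. \<Sum>j<N. cnj (x (z, j)) * (\<Sum>w\<in>Y. x (w, j) * K z w))"
      by (simp add: x_def sum_distrib_right)
    also have "\<dots> = (\<Sum>j<N. \<Sum>z\<in>Y. cnj (x (z, j)) * (\<Sum>w\<in>Y. x (w, j) * K z w))"
      by (rule sum.swap)
    finally show ?thesis by (simp add: sesq_def sum_distrib_left mult_ac)
  qed
  have form: "(\<Sum>j<N. sesq Y K (\<lambda>z. cnj (x (z, j))) (\<lambda>z. cnj (x (z, j)))) =
      sesq ?I (\<lambda>p q. K (fst p) (fst q) * (\<Sum>j<N. \<phi> (p, j) * cnj (\<phi> (q, j)))) \<xi> \<xi>"
  proof -
    have "sesq ?I (\<lambda>p q. K (fst p) (fst q) * (\<Sum>j<N. \<phi> (p, j) * cnj (\<phi> (q, j)))) \<xi> \<xi> =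
        (\<Sum>j<N. sesq ?I (\<lambda>p q. K (fst p) (fst q)) (\<lambda>p. \<xi> p * \<phi> (p, j)) (\<lambda>p. \<xi> p * \<phi> (p, j)))"
      by (simp add: sum_distrib_left mult.commute[of "K _ _"] sesq_sum sesq_congruence)
    also have "\<dots> = (\<Sum>j<N. sesq Y K (\<lambda>z. cnj (x (z, j))) (\<lambda>z. cnj (x (z, j))))"
    proof (intro sum.cong refl)
      fix j
      have "(\<Sum>p\<in>{p \<in> ?I. fst p = z}. \<xi> p * \<phi> (p, j)) = cnj (x (z, j))" if "z \<in> Y" for z
      proof -
        have "{p \<in> ?I. fst p = z} = Pair z ` {..<M}" using that by auto
        then show ?thesis by (simp add: x_def sum.reindex inj_on_def mult.commute)
      qed
      then show "sesq ?I (\<lambda>p q. K (fst p) (fst q)) (\<lambda>p. \<xi> p * \<phi> (p, j)) (\<lambda>p. \<xi> p * \<phi> (p, j)) =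
          sesq Y K (\<lambda>z. cnj (x (z, j))) (\<lambda>z. cnj (x (z, j)))"
        unfolding sesq_pullback[OF I(1) Y I(2)] by (intro sesq_cong) auto
    qed
    finally show ?thesis ..
  qed
  have cx: "c x = Re (U x)" and cx0: "0 \<le> c x"
    unfolding c_def Ux by (simp, intro sum_nonneg psd_nonneg K)
  have \<Lambda>: "0 \<le> \<Lambda>"
    unfolding \<Lambda>_def
    by (intro psd_nonneg psd_Schur_product I(1) psd_pullback[OF psd_identity I(1) _ I(3)]
        psd_pullback[OF K I(1) Y I(2)] psd_pullback[OF P I(1) Y I(2)]) auto
  have "c x \<le> \<Lambda>"
  proof (cases "c x = 0")
    case False
    then have "0 < N" "Y \<noteq> {}" by (auto simp: c_def sesq_def intro: gr0I)
    then have "(c x)\<^sup>2 \<le> c x * \<Lambda>"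
      using bound[of x] power_mono[of "c x" "cmod (U x)" 2] complex_Re_le_cmod[of "U x"] cx cx0
      by linarith
    then show ?thesis using False cx0 by (simp add: power2_eq_square)
  qed (use \<Lambda> in simp)
  then show "0 \<le> Re (sesq ?I (\<lambda>p q. of_bool (snd p = snd q) * (K (fst p) (fst q) * P (fst p) (fst q))
      - K (fst p) (fst q) * (\<Sum>j<N. \<phi> (p, j) * cnj (\<phi> (q, j)))) \<xi> \<xi>)"
    unfolding sesq_diff form[symmetric] Ux[symmetric] using cx by (simp add: \<Lambda>_def)
qed

section \<open>Contractive columns are contractive rows on finite sets\<close>

text \<open>Its positivity says that the column \<open>\<phi>\<close> multiplies the space of
  \<open>K\<close> contractively into \<open>N\<close> copies of the space of \<open>L\<close>:
  source and target kernels may differ.\<close>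

definition column_kernel ::
  "('x \<Rightarrow> 'x \<Rightarrow> complex) \<Rightarrow> ('x \<Rightarrow> 'x \<Rightarrow> complex) \<Rightarrow> ('x \<times> nat \<Rightarrow> complex) \<Rightarrow> 'x \<times> nat \<Rightarrow> 'x \<times> nat \<Rightarrow> complex"
  where "column_kernel L K \<phi> p q =
    of_bool (snd p = snd q) * L (fst p) (fst q) - K (fst p) (fst q) * (\<phi> p * cnj (\<phi> q))"

lemma column_kernel_same:
  "column_kernel K K \<phi> = (\<lambda>p q. K (fst p) (fst q) * (of_bool (snd p = snd q) - \<phi> p * cnj (\<phi> q)))"
  by (simp add: column_kernel_def fun_eq_iff algebra_simps)

section \<open>Contractive columns as inequalities between forms\<close>

lemma sesq_block_diagonal:
  "sesq (S \<times> {..<N::nat}) (\<lambda>p q. of_bool (snd p = snd q) * L (fst p) (fst q)) y y =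
    (\<Sum>i<N. sesq S L (\<lambda>z. y (z, i)) (\<lambda>z. y (z, i)))"
proof -
  have "sesq (S \<times> {..<N}) (\<lambda>p q. of_bool (snd p = snd q) * L (fst p) (fst q)) y y =
      (\<Sum>z\<in>S. \<Sum>i<N. \<Sum>w\<in>S. \<Sum>j<N. of_bool (i = j) * (y (z, i) * cnj (y (w, j)) * L z w))"
    unfolding sesq_def sum_times by (simp add: mult_ac)
  also have "\<dots> = (\<Sum>z\<in>S. \<Sum>i<N. \<Sum>w\<in>S. y (z, i) * cnj (y (w, i)) * L z w)"
    by (intro sum.cong refl) (rule sum_of_bool_mult, auto)
  also have "\<dots> = (\<Sum>i<N. sesq S L (\<lambda>z. y (z, i)) (\<lambda>z. y (z, i)))"
    unfolding sesq_def by (rule sum.swap)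
  finally show ?thesis .
qed

lemma sesq_block_outer:
  "sesq (S \<times> {..<N::nat}) (\<lambda>p q. K (fst p) (fst q) * (\<phi> p * cnj (\<phi> q))) y y =
    sesq S K (\<lambda>z. \<Sum>i<N. y (z, i) * \<phi> (z, i)) (\<lambda>z. \<Sum>i<N. y (z, i) * \<phi> (z, i))"
proof -
  have "sesq (S \<times> {..<N}) (\<lambda>p q. K (fst p) (fst q) * (\<phi> p * cnj (\<phi> q))) y y =
      (\<Sum>z\<in>S. \<Sum>i<N. \<Sum>w\<in>S. \<Sum>j<N. (y (z, i) * \<phi> (z, i)) * cnj (y (w, j) * \<phi> (w, j)) * K z w)"
    unfolding sesq_def sum_times by (simp add: mult_ac)
  also have "\<dots> = (\<Sum>z\<in>S. \<Sum>w\<in>S. \<Sum>i<N. \<Sum>j<N. (y (z, i) * \<phi> (z, i)) * cnj (y (w, j) * \<phi> (w, j)) * K z w)"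
    by (intro sum.cong refl sum.swap)
  also have "\<dots> = sesq S K (\<lambda>z. \<Sum>i<N. y (z, i) * \<phi> (z, i)) (\<lambda>z. \<Sum>i<N. y (z, i) * \<phi> (z, i))"
    unfolding sesq_def cnj_sum sum_product unfolding sum_distrib_right by simp
  finally show ?thesis .
qed

lemma sesq_column_kernel:
  "sesq (S \<times> {..<N}) (column_kernel L K \<phi>) y y =
    (\<Sum>i<N. sesq S L (\<lambda>z. y (z, i)) (\<lambda>z. y (z, i)))
    - sesq S K (\<lambda>z. \<Sum>i<N. y (z, i) * \<phi> (z, i)) (\<lambda>z. \<Sum>i<N. y (z, i) * \<phi> (z, i))"
  using sesq_block_diagonal[of S N L y] sesq_block_outer[of S N K \<phi> y]
  unfolding column_kernel_def sesq_diff by simp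

text \<open>The right side is contractivity of the adjoint on combinations of kernel functions, on
  which the adjoint acts by multiplying coefficients by those of \<open>\<phi>\<close>.\<close>

lemma psd_column_kernel_iff:
  assumes "psd S L" "psd S K"
  shows "psd (S \<times> {..<N}) (column_kernel L K \<phi>) \<longleftrightarrow>
    (\<forall>y. Re (sesq S K (\<lambda>z. \<Sum>i<N. y (z, i) * \<phi> (z, i)) (\<lambda>z. \<Sum>i<N. y (z, i) * \<phi> (z, i)))
      \<le> (\<Sum>i<N. Re (sesq S L (\<lambda>z. y (z, i)) (\<lambda>z. y (z, i)))))"
proof -
  have herm: "column_kernel L K \<phi> q p = cnj (column_kernel L K \<phi> p q)"
    if "p \<in> S \<times> {..<N}" "q \<in> S \<times> {..<N}" for p q
    using that psd_herm[OF assms(1), of "fst p" "fst q"] psd_herm[OF assms(2), of "fst p" "fst q"]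
    by (auto simp: column_kernel_def mult.commute)
  have re: "0 \<le> Re (sesq (S \<times> {..<N}) (column_kernel L K \<phi>) y y) \<longleftrightarrow>
    Re (sesq S K (\<lambda>z. \<Sum>i<N. y (z, i) * \<phi> (z, i)) (\<lambda>z. \<Sum>i<N. y (z, i) * \<phi> (z, i)))
      \<le> (\<Sum>i<N. Re (sesq S L (\<lambda>z. y (z, i)) (\<lambda>z. y (z, i))))" for y
    unfolding sesq_column_kernel by simp
  show ?thesis unfolding re[symmetric]
  proof
    show "psd (S \<times> {..<N}) (column_kernel L K \<phi>)"
      if "\<forall>y. 0 \<le> Re (sesq (S \<times> {..<N}) (column_kernel L K \<phi>) y y)"
      by (rule psdI[OF herm]) (use that in blast)+
  qed (blast intro: psd_nonneg)
qed

text \<open>Testing at the conjugate of the column, placed at the single point \<open>z\<close>,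
  bounds the square of the left side by the left side itself.\<close>

lemma column_norm_le_1:
  assumes S: "finite S" "psd S K" and z: "z \<in> S" "0 < Re (K z z)"
    and col: "psd (S \<times> {..<N}) (column_kernel K K \<phi>)"
  shows "(\<Sum>i<N. (cmod (\<phi> (z, i)))\<^sup>2) \<le> 1"
proof -
  define n where "n = (\<Sum>i<N. (cmod (\<phi> (z, i)))\<^sup>2)"
  have n: "complex_of_real n = (\<Sum>i<N. cnj (\<phi> (z, i)) * \<phi> (z, i))"
    unfolding n_def of_real_sum complex_norm_square by (simp add: mult.commute)
  have sc: "Re (sesq S K (\<lambda>w. c * of_bool (w = z)) (\<lambda>w. c * of_bool (w = z))) = (cmod c)\<^sup>2 * Re (K z z)" for c
    unfolding sesq_scale_left sesq_scale_right sesq_indicators[OF S(1) z(1) z(1)]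
    unfolding mult.assoc[symmetric] complex_norm_square[symmetric] by simp
  have "(\<Sum>i<N. cnj (\<phi> (z, i)) * of_bool (w = z) * \<phi> (w, i)) = of_real n * of_bool (w = z)" for w
    unfolding n by (cases "w = z") auto
  then have "(cmod (of_real n))\<^sup>2 * Re (K z z) \<le> (\<Sum>i<N. (cmod (cnj (\<phi> (z, i))))\<^sup>2 * Re (K z z))"
    using col unfolding psd_column_kernel_iff[OF S(2) S(2)]
    by (elim allE[where x = "\<lambda>(w, i). cnj (\<phi> (z, i)) * of_bool (w = z)"]) (simp only: split sc)
  then have "n\<^sup>2 * Re (K z z) \<le> n * Re (K z z)"
    unfolding norm_of_real power2_abs complex_mod_cnj sum_distrib_right[symmetric] n_def .
  then have n2: "n\<^sup>2 \<le> n" using z(2) by (rule mult_right_le_imp_le)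
  have "n \<le> 1"
  proof (rule ccontr)
    assume "\<not> n \<le> 1"
    then have "n * 1 < n * n" by (intro mult_strict_left_mono) auto
    then show False using n2 by (simp add: power2_eq_square)
  qed
  then show ?thesis by (simp add: n_def)
qed

text \<open>
  The automorphism of the unit ball that sends \<open>v x\<close> to 0, composed with \<open>v\<close>; here \<open>t z\<close> is the
  inner product of \<open>v z\<close> with \<open>v x\<close>.
\<close>

lemma ball_automorphism:
  fixes v :: "'x \<times> nat \<Rightarrow> complex" and N :: nat
  assumes v: "\<And>z. z \<in> S \<Longrightarrow> (\<Sum>i<N. (cmod (v (z, i)))\<^sup>2) < 1" and x: "x \<in> S"
    and K: "psd S K" and col: "psd (S \<times> {..<N}) (column_kernel K K v)"
  obtains G where "\<And>i. G (x, i) = 0" "psd (S \<times> {..<N}) (column_kernel K K G)"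
    "psd S (\<lambda>z w. K z w * (1 - (\<Sum>i<N. G (z, i) * cnj (G (w, i))))) \<Longrightarrow>
     psd S (\<lambda>z w. K z w * (1 - (\<Sum>i<N. v (z, i) * cnj (v (w, i)))))"
proof -
  define a where "a i = v (x, i)" for i
  define t where "t z = (\<Sum>i<N. v (z, i) * cnj (a i))" for z
  define s where "s = sqrt (1 - (\<Sum>i<N. (cmod (a i))\<^sup>2))"
  define k where "k = 1 / (1 + s)"
  have s0: "0 < s" unfolding s_def a_def using v[OF x] by simp
  have A: "(\<Sum>i<N. a i * cnj (a i)) = 1 - (of_real s)\<^sup>2"
    unfolding complex_norm_square[symmetric] using v[OF x] by (simp add: s_def a_def flip: of_real_power)
  have ks: "complex_of_real k * (1 + of_real s) = 1"
  proof -
    have "k * (1 + s) = 1" using s0 by (simp add: k_def)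
    then have "complex_of_real (k * (1 + s)) = of_real 1" by (rule arg_cong)
    then show ?thesis by simp
  qed
  have t1: "1 - t z \<noteq> 0" if "z \<in> S" for z
  proof -
    have n: "sesq {..<N} (\<lambda>i j. of_bool (i = j)) y y = of_real (\<Sum>i<N. (cmod (y i))\<^sup>2)" for y
      unfolding sesq_identity[OF finite_lessThan] complex_norm_square[symmetric] by simp
    have "(cmod (t z))\<^sup>2 \<le> (\<Sum>i<N. (cmod (v (z, i)))\<^sup>2) * (\<Sum>i<N. (cmod (a i))\<^sup>2)"
      using psd_Cauchy_Schwarz[OF psd_identity[OF finite_lessThan], of N "\<lambda>i. v (z, i)" a]
      unfolding n unfolding sesq_identity[OF finite_lessThan] t_def Re_complex_of_real .
    also have "\<dots> < 1 * 1"
      using v[OF that] v[OF x] by (intro mult_strict_mono') (auto simp: a_def sum_nonneg)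
    finally have "cmod (t z) < 1" by (simp add: power_less_one_iff)
    then show ?thesis by auto
  qed
  \<comment> \<open>Minus the classical involution exchanging \<open>a\<close> and \<open>0\<close>.
    Its projection onto \<open>a\<close> has coefficient \<open>(1 - s)\<close> over the squared
    norm of \<open>a\<close>, which equals \<open>k = 1 / (1 + s)\<close>; in this form
    \<open>a = 0\<close> is no special case.\<close>
  define G where "G p = (of_real s * v p - (1 - of_real k * t (fst p)) * a (snd p)) / (1 - t (fst p))" for p
  show ?thesis
  proof
    have "t x = 1 - (of_real s)\<^sup>2" unfolding t_def A[symmetric] by (simp add: a_def)
    then have "of_real s - (1 - of_real k * t x) = 0"
      using ks by algebra
    then have "of_real s * a i - (1 - of_real k * t x) * a i = 0" for i
      by (metis left_diff_distrib mult_zero_left)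
    then show "G (x, i) = 0" for i by (simp add: G_def flip: a_def)
  next
    have "Re (sesq S K (\<lambda>z. \<Sum>i<N. y (z, i) * G (z, i)) (\<lambda>z. \<Sum>i<N. y (z, i) * G (z, i)))
        \<le> (\<Sum>i<N. Re (sesq S K (\<lambda>z. y (z, i)) (\<lambda>z. y (z, i))))" for y
    proof -
      \<comment> \<open>The pair \<open>(Y, \<beta>)\<close> is a test vector for \<open>v\<close>
        together with its pairing with \<open>v\<close>. Passing to
        \<open>(y, s \<beta> - \<mu>)\<close> preserves the indefinite form of \<open>YY\<close>, so
        the defect of \<open>G\<close> at \<open>y\<close> is the defect of \<open>v\<close> at
        \<open>Y\<close>.\<close>
      define \<mu> where "\<mu> z = (\<Sum>i<N. y (z, i) * a i)" for z
      define \<beta> where "\<beta> z = ((\<Sum>i<N. y (z, i) * v (z, i)) - of_real k * \<mu> z * t z) / (1 - t z)" for z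
      define \<gamma> where "\<gamma> z = \<beta> z - of_real k * \<mu> z" for z
      define Y where "Y p = y p + \<gamma> (fst p) * cnj (a (snd p))" for p
      have Yv: "(\<Sum>i<N. Y (z, i) * v (z, i)) = \<beta> z" if "z \<in> S" for z
      proof -
        have "(\<Sum>i<N. Y (z, i) * v (z, i)) = (\<Sum>i<N. y (z, i) * v (z, i)) + \<gamma> z * t z"
          by (simp add: Y_def t_def algebra_simps sum.distrib sum_distrib_left)
        then show ?thesis using t1[OF that] by (simp add: \<gamma>_def \<beta>_def field_simps)
      qed
      have yG: "(\<Sum>i<N. y (z, i) * G (z, i)) = of_real s * \<beta> z - \<mu> z" if "z \<in> S" for z
      proof -
        have "(\<Sum>i<N. y (z, i) * G (z, i)) =
            (of_real s * (\<Sum>i<N. y (z, i) * v (z, i)) - (1 - of_real k * t z) * \<mu> z) / (1 - t z)"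
          by (simp add: G_def \<mu>_def algebra_simps sum_subtractf sum.distrib sum_distrib_left
              sum_divide_distrib diff_divide_distrib add_divide_distrib)
        moreover have "of_real s * (\<Sum>i<N. y (z, i) * v (z, i)) - (1 - of_real k * t z) * \<mu> z =
            of_real s * ((\<Sum>i<N. y (z, i) * v (z, i)) - of_real k * \<mu> z * t z) - \<mu> z * (1 - t z)"
          using ks by algebra
        moreover have "(of_real s * c - \<mu> z * (1 - t z)) / (1 - t z) = of_real s * (c / (1 - t z)) - \<mu> z" for c
          using t1[OF that] by (simp add: field_simps)
        ultimately show ?thesis unfolding \<beta>_def by (simp only:)
      qed
      have YY: "(\<Sum>i<N. Y (z, i) * cnj (Y (w, i))) - \<beta> z * cnj (\<beta> w) =
          (\<Sum>i<N. y (z, i) * cnj (y (w, i))) - (of_real s * \<beta> z - \<mu> z) * cnj (of_real s * \<beta> w - \<mu> w)" for z w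
      proof -
        have "(\<Sum>i<N. Y (z, i) * cnj (Y (w, i))) = (\<Sum>i<N. y (z, i) * cnj (y (w, i)))
            + cnj (\<gamma> w) * \<mu> z + \<gamma> z * cnj (\<mu> w) + \<gamma> z * cnj (\<gamma> w) * (\<Sum>i<N. a i * cnj (a i))"
          by (simp add: Y_def \<mu>_def algebra_simps sum.distrib sum_distrib_left)
        moreover have "cnj (\<gamma> w) = cnj (\<beta> w) - of_real k * cnj (\<mu> w)" by (simp add: \<gamma>_def)
        ultimately show ?thesis unfolding A \<gamma>_def[of z]
          using ks by (simp, algebra)
      qed
      have eq: "(\<Sum>i<N. sesq S K (\<lambda>z. f (z, i)) (\<lambda>z. f (z, i))) - sesq S K g g =
          (\<Sum>z\<in>S. \<Sum>w\<in>S. K z w * ((\<Sum>i<N. f (z, i) * cnj (f (w, i))) - g z * cnj (g w)))" for f g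
      proof -
        have "(\<Sum>i<N. sesq S K (\<lambda>z. f (z, i)) (\<lambda>z. f (z, i))) =
            (\<Sum>z\<in>S. \<Sum>i<N. \<Sum>w\<in>S. f (z, i) * cnj (f (w, i)) * K z w)"
          unfolding sesq_def by (rule sum.swap)
        also have "\<dots> = (\<Sum>z\<in>S. \<Sum>w\<in>S. \<Sum>i<N. f (z, i) * cnj (f (w, i)) * K z w)"
          by (intro sum.cong refl sum.swap)
        finally show ?thesis
          by (simp add: sesq_def sum_subtractf right_diff_distrib sum_distrib_left mult_ac)
      qed
      have "(\<Sum>i<N. sesq S K (\<lambda>z. y (z, i)) (\<lambda>z. y (z, i)))
          - sesq S K (\<lambda>z. \<Sum>i<N. y (z, i) * G (z, i)) (\<lambda>z. \<Sum>i<N. y (z, i) * G (z, i)) =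
          (\<Sum>i<N. sesq S K (\<lambda>z. Y (z, i)) (\<lambda>z. Y (z, i)))
          - sesq S K (\<lambda>z. \<Sum>i<N. Y (z, i) * v (z, i)) (\<lambda>z. \<Sum>i<N. Y (z, i) * v (z, i))"
        unfolding eq by (intro sum.cong refl) (simp only: Yv yG YY)
      then have "Re ((\<Sum>i<N. sesq S K (\<lambda>z. y (z, i)) (\<lambda>z. y (z, i)))
          - sesq S K (\<lambda>z. \<Sum>i<N. y (z, i) * G (z, i)) (\<lambda>z. \<Sum>i<N. y (z, i) * G (z, i))) =
          Re ((\<Sum>i<N. sesq S K (\<lambda>z. Y (z, i)) (\<lambda>z. Y (z, i)))
          - sesq S K (\<lambda>z. \<Sum>i<N. Y (z, i) * v (z, i)) (\<lambda>z. \<Sum>i<N. Y (z, i) * v (z, i)))"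
        by (rule arg_cong)
      moreover have "Re (sesq S K (\<lambda>z. \<Sum>i<N. Y (z, i) * v (z, i)) (\<lambda>z. \<Sum>i<N. Y (z, i) * v (z, i)))
          \<le> (\<Sum>i<N. Re (sesq S K (\<lambda>z. Y (z, i)) (\<lambda>z. Y (z, i))))"
        using col unfolding psd_column_kernel_iff[OF K K] by blast
      ultimately show ?thesis by simp
    qed
    then show "psd (S \<times> {..<N}) (column_kernel K K G)"
      unfolding psd_column_kernel_iff[OF K K] by blast
  next
    assume row: "psd S (\<lambda>z w. K z w * (1 - (\<Sum>i<N. G (z, i) * cnj (G (w, i)))))"
    \<comment> \<open>The ball automorphism identity: \<open>1\<close> minus the inner product for
      \<open>v\<close> is \<open>1\<close> minus the one for \<open>G\<close>, up to a
      congruence.\<close>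
    have "K z w * (1 - (\<Sum>i<N. v (z, i) * cnj (v (w, i)))) =
      ((1 - t z) / of_real s) * cnj ((1 - t w) / of_real s) * (K z w * (1 - (\<Sum>i<N. G (z, i) * cnj (G (w, i)))))"
      if zw: "z \<in> S" "w \<in> S" for z w
    proof -
      define V where "V = (\<Sum>i<N. v (z, i) * cnj (v (w, i)))"
      have tw: "1 - cnj (t w) \<noteq> 0" using t1[OF zw(2)]
        by (metis complex_cnj_diff complex_cnj_one complex_cnj_zero_iff)
      have tw': "(\<Sum>i<N. a i * cnj (v (w, i))) = cnj (t w)" by (simp add: t_def mult.commute)
      have dot: "(\<Sum>i<N. (c * v (z, i) - e * a i) * cnj (c' * v (w, i) - e' * a i)) =
          c * cnj c' * V - c * cnj e' * t z - e * cnj c' * cnj (t w) + e * cnj e' * (\<Sum>i<N. a i * cnj (a i))" for c e c' e'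
        unfolding V_def t_def[of z] tw'[symmetric]
        by (simp add: algebra_simps sum.distrib sum_subtractf sum_distrib_left)
      have "((1 - t z) * (1 - cnj (t w))) * (\<Sum>i<N. G (z, i) * cnj (G (w, i))) =
          (\<Sum>i<N. (of_real s * v (z, i) - (1 - of_real k * t z) * a i)
            * cnj (of_real s * v (w, i) - (1 - of_real k * t w) * a i))"
        unfolding sum_distrib_left using t1[OF zw(1)] tw by (intro sum.cong refl) (simp add: G_def)
      also have "\<dots> = (of_real s)\<^sup>2 * V - of_real s * (1 - of_real k * cnj (t w)) * t z
          - of_real s * (1 - of_real k * t z) * cnj (t w)
          + (1 - of_real k * t z) * (1 - of_real k * cnj (t w)) * (1 - (of_real s)\<^sup>2)"
        unfolding dot A by (simp add: power2_eq_square)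
      finally have "((1 - t z) * (1 - cnj (t w))) * (1 - (\<Sum>i<N. G (z, i) * cnj (G (w, i)))) = (of_real s)\<^sup>2 * (1 - V)"
        using ks by algebra
      moreover have "((1 - t z) / of_real s) * cnj ((1 - t w) / of_real s) * (K z w * X) =
          K z w * (((1 - t z) * (1 - cnj (t w))) * X) / (of_real s)\<^sup>2" for X
        by (simp add: power2_eq_square)
      ultimately show ?thesis using s0 by (simp add: V_def)
    qed
    then show "psd S (\<lambda>z w. K z w * (1 - (\<Sum>i<N. v (z, i) * cnj (v (w, i)))))"
      using psd_congruence[OF row, of "\<lambda>z. (1 - t z) / of_real s"] by (subst psd_cong) assumption+
  qed
qed

text \<open>Up to a congruence this is the Gram kernel of the points after a ball automorphism
  sending the point of \<open>x\<close> to 0, where \<open>B\<close> is the original Gram kernel.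
  The proof needs only Cauchy-Schwarz for \<open>B\<close>.\<close>

lemma psd_complement_multiplier:
  fixes B :: "'x \<Rightarrow> 'x \<Rightarrow> complex"
  assumes S: "finite S" "x \<in> S" and B: "psd S B" and x: "Re (B x x) < 1"
  shows "psd S (\<lambda>z w. (1 - B z x) * cnj (1 - B w x) / of_real (1 - Re (B x x)) - 1 + B z w)"
proof (rule psdI)
  show "(1 - B q x) * cnj (1 - B p x) / of_real (1 - Re (B x x)) - 1 + B q p =
      cnj ((1 - B p x) * cnj (1 - B q x) / of_real (1 - Re (B x x)) - 1 + B p q)"
    if "p \<in> S" "q \<in> S" for p q
    using psd_herm[OF B that] by (simp add: mult.commute)
next
  fix y :: "'x \<Rightarrow> complex"
  define b where "b = Re (B x x)"
  have b: "0 \<le> b" "b < 1" "B x x = of_real b" using psd_diag[OF B S] x by (auto simp: b_def)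
  define s where "s = (\<Sum>p\<in>S. y p)"
  define q where "q = (\<Sum>p\<in>S. y p * B p x)"
  define Q where "Q = Re (sesq S B y y)"
  have q: "(cmod q)\<^sup>2 \<le> Q * b"
    using psd_Cauchy_Schwarz[OF B, of y "\<lambda>p. of_bool (p = x)"]
    by (simp add: sesq_indicator_right[OF S] q_def Q_def b_def S sesq_indicators)
  have one: "sesq S (\<lambda>z w. 1) y y = s * cnj s" by (simp add: sesq_def s_def sum_product)
  have "sesq S (\<lambda>z w. of_real (1 / (1 - b)) * ((1 - B z x) * cnj (1 - B w x)) - 1 + B z w) y y
      = of_real (1 / (1 - b)) * ((s - q) * cnj (s - q)) - s * cnj s + sesq S B y y"
    unfolding sesq_add sesq_diff sesq_cmult sesq_outer one
    by (simp add: s_def q_def right_diff_distrib sum_subtractf)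
  then have "Re (sesq S (\<lambda>z w. (1 - B z x) * cnj (1 - B w x) / of_real (1 - Re (B x x)) - 1 + B z w) y y)
      = (cmod (s - q))\<^sup>2 / (1 - b) - (cmod s)\<^sup>2 + Q"
    unfolding complex_norm_square[symmetric] by (simp add: b_def Q_def flip: of_real_power)
  moreover have "(cmod s)\<^sup>2 \<le> (cmod (s - q))\<^sup>2 / (1 - b) + Q"
  proof -
    define d e where "d = cmod (s - q)" and "e = cmod q"
    have "cmod s \<le> d + e" unfolding d_def e_def by (metis diff_add_cancel norm_triangle_ineq)
    then have "(cmod s)\<^sup>2 \<le> (d + e)\<^sup>2" by (intro power_mono) auto
    also have "\<dots> \<le> d\<^sup>2 / (1 - b) + Q"
    proof (cases "b = 0")
      case True
      then have "e = 0" using q by (simp add: e_def)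
      then show ?thesis using True psd_nonneg[OF B, of y] by (simp add: Q_def)
    next
      case False
      then have b0: "0 < b" using b by simp
      \<comment> \<open>Weighted Cauchy-Schwarz with weights \<open>1 - b\<close> and
        \<open>b\<close>, which sum to \<open>1\<close>.\<close>
      have "0 \<le> (d * b - e * (1 - b))\<^sup>2 / (b * (1 - b))" using b0 b by simp
      also have "\<dots> = d\<^sup>2 / (1 - b) + e\<^sup>2 / b - (d + e)\<^sup>2"
        using b0 b by (simp add: field_simps power2_eq_square)
      also have "e\<^sup>2 / b \<le> Q" using q b0 by (simp add: e_def field_simps)
      finally show ?thesis by simp
    qed
    finally show ?thesis by (simp add: d_def)
  qed
  ultimately show "0 \<le> Re (sesq S (\<lambda>z w. (1 - B z x) * cnj (1 - B w x) / of_real (1 - Re (B x x)) - 1 + B z w) y y)"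
    by simp
qed

lemma sesq_insert:
  assumes "finite S" "x \<notin> S"
  shows "sesq (insert x S) A u v = u x * cnj (v x) * A x x + u x * (\<Sum>q\<in>S. cnj (v q) * A x q)
    + cnj (v x) * (\<Sum>p\<in>S. u p * A p x) + sesq S A u v"
  using assms by (simp add: sesq_def sum.distrib sum_distrib_left mult_ac)

text \<open>After moving the value at \<open>x\<close> to 0, the column maps into the functions
  vanishing at \<open>x\<close>. Their kernel is \<open>L = K P\<close>, so the stacked-column bound
  on \<open>S\<close>, which uses contractive rows only there, gives the row inequality with target
  \<open>L\<close>; this is the Schur complement at \<open>x\<close> of the desired one.\<close>

lemma row_of_strict_column_step:
  fixes S :: "'x set" and K B :: "'x \<Rightarrow> 'x \<Rightarrow> complex" and v :: "'x \<times> nat \<Rightarrow> complex"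
  assumes S: "finite S" "x \<notin> S" and K: "psd (insert x S) K" and B: "psd (insert x S) B"
    and KB: "\<And>z w. z \<in> insert x S \<Longrightarrow> w \<in> insert x S \<Longrightarrow> K z w * (1 - B z w) = 1"
    and row: "\<And>\<Theta>. psd (S \<times> {..<N}) (column_kernel K K \<Theta>)
      \<Longrightarrow> psd S (\<lambda>z w. K z w * (1 - (\<Sum>j<N. \<Theta> (z, j) * cnj (\<Theta> (w, j)))))"
    and v: "\<And>z. z \<in> insert x S \<Longrightarrow> (\<Sum>i<N. (cmod (v (z, i)))\<^sup>2) < 1"
    and col: "psd (insert x S \<times> {..<N}) (column_kernel K K v)"
  shows "psd (insert x S) (\<lambda>z w. K z w * (1 - (\<Sum>i<N. v (z, i) * cnj (v (w, i)))))"
proof -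
  let ?T = "insert x S"
  have T: "finite ?T" "x \<in> ?T" using S by auto
  have KS: "psd S K" and BS: "psd S B"
    using psd_subset[OF _ subset_insertI T(1)] K B by auto
  obtain G where G0: "\<And>i. G (x, i) = 0" and colG: "psd (?T \<times> {..<N}) (column_kernel K K G)"
    and rowG: "psd ?T (\<lambda>z w. K z w * (1 - (\<Sum>i<N. G (z, i) * cnj (G (w, i))))) \<Longrightarrow>
     psd ?T (\<lambda>z w. K z w * (1 - (\<Sum>i<N. v (z, i) * cnj (v (w, i)))))"
    by (rule ball_automorphism[OF v T(2) K col]) blast+
  define a where "a = Re (K x x)"
  have a: "K x x = of_real a" "0 < a"
  proof -
    show "K x x = of_real a" using psd_diag[OF K T] by (simp add: a_def)
    then show "0 < a" using psd_diag(1)[OF K T] KB[OF T(2) T(2)] by (cases "a = 0") (auto simp: a_def)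
  qed
  define b where "b = Re (B x x)"
  have b: "B x x = of_real b" "a * (1 - b) = 1"
  proof -
    show "B x x = of_real b" using psd_diag[OF B T] by (simp add: b_def)
    then have "complex_of_real (a * (1 - b)) = of_real 1" using KB[OF T(2) T(2)] a by simp
    then show "a * (1 - b) = 1" unfolding of_real_eq_iff .
  qed
  have b1: "0 < 1 - b" using b(2) a(2) by (metis zero_less_mult_pos zero_less_one)
  define L where "L z w = K z w - K z x * K x w / K x x" for z w
  \<comment> \<open>The quotient is
    \<open>1 - (1 - B x x) (1 - B z w) / ((1 - B z x) (1 - B x w))\<close>, a congruence of the
    kernel in \<open>psd_complement_multiplier\<close>.\<close>
  define P where "P z w = L z w / K z w" for z w
  have Knz: "K z w \<noteq> 0" if "z \<in> ?T" "w \<in> ?T" for z w using KB[OF that] by auto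
  have KP: "K z w * P z w = L z w" if "z \<in> S" "w \<in> S" for z w
    using Knz that by (simp add: P_def)
  have P: "psd S P"
  proof (rule psd_subset[OF _ subset_insertI T(1)])
    have Keq: "K z w = 1 / (1 - B z w)" if "z \<in> ?T" "w \<in> ?T" for z w
      using KB[OF that] by (metis mult_zero_right nonzero_eq_divide_eq zero_neq_one)
    have nz: "1 - B z w \<noteq> 0" if "z \<in> ?T" "w \<in> ?T" for z w using KB[OF that] by auto
    define u where "u z = of_real (sqrt (1 - b)) / (1 - B z x)" for z
    have "P z w = u z * cnj (u w) * ((1 - B z x) * cnj (1 - B w x) / of_real (1 - Re (B x x)) - 1 + B z w)"
      if zw: "z \<in> ?T" "w \<in> ?T" for z w
    proof -
      have h: "cnj (1 - B w x) = 1 - B x w" using psd_herm[OF B zw(2) T(2)] by simp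
      have sq: "complex_of_real (sqrt (1 - b)) * of_real (sqrt (1 - b)) = 1 - of_real b"
        using b1 by (simp flip: of_real_mult)
      have uu: "u z * cnj (u w) = (1 - of_real b) / ((1 - B z x) * (1 - B x w))"
        unfolding u_def sq[symmetric] h[symmetric] by simp
      have bnz: "1 - complex_of_real b \<noteq> 0" using b1
        by (metis of_real_1 of_real_diff of_real_eq_0_iff less_irrefl)
      define \<alpha> \<beta> \<gamma> where "\<alpha> = 1 - B z x" and "\<beta> = 1 - B x w" and "\<gamma> = 1 - B z w"
      have "(1 / \<gamma> - 1 / \<alpha> * (1 / \<beta>) / (1 / e)) / (1 / \<gamma>) = e / (\<alpha> * \<beta>) * (\<alpha> * \<beta> / e - \<gamma>)" if "e \<noteq> 0" for e
        using nz[OF zw] nz[OF zw(1) T(2)] nz[OF T(2) zw(2)] that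
        unfolding \<alpha>_def[symmetric] \<beta>_def[symmetric] \<gamma>_def[symmetric] by (simp add: field_simps)
      from this[OF bnz] show ?thesis
        unfolding uu h P_def L_def Keq[OF zw] Keq[OF zw(1) T(2)] Keq[OF T(2) zw(2)] Keq[OF T(2) T(2)] b(1)
          \<alpha>_def[symmetric] \<beta>_def[symmetric] \<gamma>_def[symmetric]
        by (simp add: \<gamma>_def)
    qed
    then show "psd ?T P"
      using psd_congruence[OF psd_complement_multiplier[OF T B], of u] b1
      by (subst psd_cong) (assumption, simp add: b_def)
  qed
  \<comment> \<open>The value put at \<open>x\<close> makes the combination orthogonal to the kernel
    function at \<open>x\<close>, that is, projects it onto the functions vanishing there.\<close>
  have Ly: "sesq S L y y = sesq ?T K (\<lambda>z. if z = x then - (\<Sum>w\<in>S. y w * K w x) / K x x else y z)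
      (\<lambda>z. if z = x then - (\<Sum>w\<in>S. y w * K w x) / K x x else y z)" for y
  proof -
    define s where "s = (\<Sum>w\<in>S. y w * K w x)"
    have s': "(\<Sum>w\<in>S. cnj (y w) * K x w) = cnj s"
      unfolding s_def cnj_sum using psd_herm[OF K _ T(2)] by (intro sum.cong refl) auto
    let ?y = "\<lambda>z. if z = x then - s / K x x else y z"
    have "sesq ?T K ?y ?y = ?y x * cnj (?y x) * K x x + ?y x * (\<Sum>w\<in>S. cnj (?y w) * K x w)
        + cnj (?y x) * (\<Sum>w\<in>S. ?y w * K w x) + sesq S K ?y ?y"
      by (rule sesq_insert[OF S])
    also have "(\<Sum>w\<in>S. cnj (?y w) * K x w) = (\<Sum>w\<in>S. cnj (y w) * K x w)"
      using S(2) by (intro sum.cong) auto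
    also have "(\<Sum>w\<in>S. ?y w * K w x) = s"
      unfolding s_def using S(2) by (intro sum.cong) auto
    also have "sesq S K ?y ?y = sesq S K y y"
      using S(2) by (intro sesq_cong) auto
    also have "?y x * cnj (?y x) * K x x + ?y x * (\<Sum>w\<in>S. cnj (y w) * K x w) + cnj (?y x) * s + sesq S K y y =
        sesq S K y y - s * cnj s / of_real a"
      unfolding s' using a by (simp add: field_simps)
    also have "\<dots> = sesq S L y y"
    proof -
      have "sesq S L y y = sesq S (\<lambda>p q. K p q - of_real (1 / a) * (K p x * cnj (K q x))) y y"
      proof (intro sesq_cong refl)
        fix p q assume "q \<in> S"
        then have "cnj (K q x) = K x q" using psd_herm[OF K T(2), of q] by simp
        then show "L p q = K p q - of_real (1 / a) * (K p x * cnj (K q x))" using a by (simp add: L_def)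
      qed
      then show ?thesis unfolding sesq_diff sesq_cmult sesq_outer s_def[symmetric] by simp
    qed
    finally show ?thesis unfolding s_def by (rule sym)
  qed
  have L: "psd S L"
  proof (rule psdI)
    show "L q p = cnj (L p q)" if "p \<in> S" "q \<in> S" for p q
      unfolding L_def using psd_herm[OF K, of p q] psd_herm[OF K, of p x] psd_herm[OF K, of x q] that a
      by simp
  qed (unfold Ly, rule psd_nonneg[OF K])
  \<comment> \<open>Since \<open>G\<close> vanishes at \<open>x\<close>, the extra coefficient at
    \<open>x\<close> does not enter the pairing with \<open>G\<close>, and the target may shrink
    from \<open>K\<close> to \<open>L\<close>.\<close>
  have colL: "psd (S \<times> {..<N}) (column_kernel L K G)"
    unfolding psd_column_kernel_iff[OF L KS]
  proof
    fix y :: "'x \<times> nat \<Rightarrow> complex"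
    define y' where "y' p = (if fst p = x then - (\<Sum>w\<in>S. y (w, snd p) * K w x) / K x x else y p)" for p
    have "sesq S K (\<lambda>z. \<Sum>i<N. y (z, i) * G (z, i)) (\<lambda>z. \<Sum>i<N. y (z, i) * G (z, i)) =
        sesq ?T K (\<lambda>z. \<Sum>i<N. y' (z, i) * G (z, i)) (\<lambda>z. \<Sum>i<N. y' (z, i) * G (z, i))"
    proof -
      have "(\<Sum>i<N. y' (z, i) * G (z, i)) = (\<Sum>i<N. y (z, i) * G (z, i))" if "z \<in> S" for z
        using that S(2) by (intro sum.cong) (auto simp: y'_def)
      then show ?thesis
        unfolding sesq_insert[OF S] using S(2) by (auto simp: G0 simp del: cnj_sum intro!: sesq_cong)
    qed
    moreover have "sesq S L (\<lambda>z. y (z, i)) (\<lambda>z. y (z, i)) = sesq ?T K (\<lambda>z. y' (z, i)) (\<lambda>z. y' (z, i))" for i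
      unfolding Ly y'_def fst_conv snd_conv ..
    ultimately show "Re (sesq S K (\<lambda>z. \<Sum>i<N. y (z, i) * G (z, i)) (\<lambda>z. \<Sum>i<N. y (z, i) * G (z, i)))
        \<le> (\<Sum>i<N. Re (sesq S L (\<lambda>z. y (z, i)) (\<lambda>z. y (z, i))))"
      using colG unfolding psd_column_kernel_iff[OF K K] by simp
  qed
  define \<phi> where "\<phi> p = G (fst (fst p), snd p)" for p :: "('x \<times> nat) \<times> nat"
  \<comment> \<open>The column is read as the stacking of a matrix with a single row.\<close>
  have "psd ((S \<times> {..<1::nat}) \<times> {..<N}) (\<lambda>p q. column_kernel L K G (fst (fst p), snd p) (fst (fst q), snd q))"
    by (rule psd_pullback[OF colL, where f = "\<lambda>p. (fst (fst p), snd p)"]) (use S in auto)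
  then have st: "psd ((S \<times> {..<1::nat}) \<times> {..<N}) (\<lambda>p q. of_bool (snd (fst p) = snd (fst q)) * of_bool (snd p = snd q) *
      (K (fst (fst p)) (fst (fst q)) * P (fst (fst p)) (fst (fst q))) - K (fst (fst p)) (fst (fst q)) * (\<phi> p * cnj (\<phi> q)))"
    by (subst (asm) psd_cong) (auto simp: column_kernel_def \<phi>_def KP)
  have "psd (S \<times> {..<1::nat}) (\<lambda>p q. of_bool (snd p = snd q) * (K (fst p) (fst q) * P (fst p) (fst q))
    - K (fst p) (fst q) * (\<Sum>j<N. \<phi> (p, j) * cnj (\<phi> (q, j))))"
  proof (rule psd_matrix_of_stacked[OF S(1) KS BS P _ _ st])
    fix \<Theta>
    assume "psd (S \<times> {..<N}) (\<lambda>p q. K (fst p) (fst q) * (of_bool (snd p = snd q) - \<Theta> p * cnj (\<Theta> q)))"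
    then show "psd S (\<lambda>z w. K z w * (1 - (\<Sum>j<N. \<Theta> (z, j) * cnj (\<Theta> (w, j)))))"
      unfolding column_kernel_same[symmetric] by (rule row)
  qed (use KB in auto)
  from psd_pullback[OF this, of S "\<lambda>z. (z, 0)"] S(1)
  have "psd S (\<lambda>z w. K z w * P z w - K z w * (\<Sum>j<N. G (z, j) * cnj (G (w, j))))"
    by (simp add: \<phi>_def image_subset_iff)
  then have "psd S (\<lambda>z w. L z w - K z w * (\<Sum>j<N. G (z, j) * cnj (G (w, j))))"
    by (subst (asm) psd_cong) (auto simp: KP)
  \<comment> \<open>As \<open>G\<close> is 0 at \<open>x\<close>, all corrections in row and column
    \<open>x\<close> disappear, so the kernel just obtained is a Schur complement.\<close>
  then have "psd S (\<lambda>z w. K z w * (1 - (\<Sum>i<N. G (z, i) * cnj (G (w, i))))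
      - K z x * (1 - (\<Sum>i<N. G (z, i) * cnj (G (x, i)))) * (K x w * (1 - (\<Sum>i<N. G (x, i) * cnj (G (w, i)))))
        / (K x x * (1 - (\<Sum>i<N. G (x, i) * cnj (G (x, i))))))"
    by (simp add: G0 L_def algebra_simps)
  then have "psd ?T (\<lambda>z w. K z w * (1 - (\<Sum>i<N. G (z, i) * cnj (G (w, i)))))"
  proof (rule psd_insert_schur)
    show "K q p * (1 - (\<Sum>i<N. G (q, i) * cnj (G (p, i)))) = cnj (K p q * (1 - (\<Sum>i<N. G (p, i) * cnj (G (q, i)))))"
      if "p \<in> S" "q \<in> S" for p q
      using psd_herm[OF KS that] by (simp add: mult.commute)
    show "K x p * (1 - (\<Sum>i<N. G (x, i) * cnj (G (p, i)))) = cnj (K p x * (1 - (\<Sum>i<N. G (p, i) * cnj (G (x, i)))))"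
      if "p \<in> S" for p
      using psd_herm[OF K, of p x] that by (simp add: G0)
  qed (use S a G0 in auto)
  then show ?thesis by (rule rowG)
qed

lemma row_of_column:
  fixes S :: "'x set" and K B :: "'x \<Rightarrow> 'x \<Rightarrow> complex" and \<Phi> :: "'x \<times> nat \<Rightarrow> complex"
  assumes "finite S" "psd S K" "psd S B"
    and "\<And>z w. z \<in> S \<Longrightarrow> w \<in> S \<Longrightarrow> K z w * (1 - B z w) = 1"
    and "psd (S \<times> {..<N}) (column_kernel K K \<Phi>)"
  shows "psd S (\<lambda>z w. K z w * (1 - (\<Sum>i<N. \<Phi> (z, i) * cnj (\<Phi> (w, i)))))"
  using assms
proof (induction S arbitrary: \<Phi> rule: finite_induct)
  case empty
  then show ?case by (simp add: psd_def sesq_def)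
next
  case (insert x S)
  let ?T = "insert x S"
  have T: "finite ?T" using insert by auto
  note K = insert.prems(1) and B = insert.prems(2) and KB = insert.prems(3) and col = insert.prems(4)
  have KS: "psd S K" "psd S B" using psd_subset[OF _ subset_insertI T] K B by auto
  define v where "v n p = of_real (real n / real (Suc n)) * \<Phi> p" for n p
  have "psd ?T (\<lambda>z w. K z w * (1 - (\<Sum>i<N. v n (z, i) * cnj (v n (w, i)))))" for n
  proof (rule row_of_strict_column_step[OF insert.hyps K B])
    define r where "r = real n / real (Suc n)"
    have r: "0 \<le> r" "r\<^sup>2 < 1" by (auto simp: r_def power_less_one_iff)
    fix z assume z: "z \<in> ?T"
    have "0 < Re (K z z)"
      using psd_diag[OF K T z] KB[OF z z] by (cases "Re (K z z) = 0") auto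
    then have "(\<Sum>i<N. (cmod (\<Phi> (z, i)))\<^sup>2) \<le> 1"
      by (rule column_norm_le_1[OF T K z _ col])
    then have "r\<^sup>2 * (\<Sum>i<N. (cmod (\<Phi> (z, i)))\<^sup>2) \<le> r\<^sup>2 * 1" by (intro mult_left_mono) auto
    then show "(\<Sum>i<N. (cmod (v n (z, i)))\<^sup>2) < 1"
      using r unfolding v_def r_def[symmetric]
      by (simp add: norm_mult power_mult_distrib sum_distrib_left)
  next
    define r where "r = real n / real (Suc n)"
    have r: "0 \<le> r" "r\<^sup>2 < 1" by (auto simp: r_def power_less_one_iff)
    show "psd (?T \<times> {..<N}) (column_kernel K K (v n))"
      unfolding psd_column_kernel_iff[OF K K]
    proof
      fix y
      have "Re (sesq ?T K (\<lambda>z. \<Sum>i<N. y (z, i) * v n (z, i)) (\<lambda>z. \<Sum>i<N. y (z, i) * v n (z, i)))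
         = r\<^sup>2 * Re (sesq ?T K (\<lambda>z. \<Sum>i<N. y (z, i) * \<Phi> (z, i)) (\<lambda>z. \<Sum>i<N. y (z, i) * \<Phi> (z, i)))"
      proof -
        have "(\<Sum>i<N. y (z, i) * v n (z, i)) = of_real r * (\<Sum>i<N. y (z, i) * \<Phi> (z, i))" for z
          unfolding v_def r_def[symmetric] by (simp add: sum_distrib_left mult_ac)
        then show ?thesis
          by (simp only: sesq_scale_left sesq_scale_right) (simp add: power2_eq_square)
      qed
      also have "\<dots> \<le> 1 * Re (sesq ?T K (\<lambda>z. \<Sum>i<N. y (z, i) * \<Phi> (z, i)) (\<lambda>z. \<Sum>i<N. y (z, i) * \<Phi> (z, i)))"
        using r by (intro mult_right_mono psd_nonneg K) auto
      also have "\<dots> \<le> (\<Sum>i<N. Re (sesq ?T K (\<lambda>z. y (z, i)) (\<lambda>z. y (z, i))))"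
        using col unfolding psd_column_kernel_iff[OF K K] by simp
      finally show "Re (sesq ?T K (\<lambda>z. \<Sum>i<N. y (z, i) * v n (z, i)) (\<lambda>z. \<Sum>i<N. y (z, i) * v n (z, i)))
        \<le> (\<Sum>i<N. Re (sesq ?T K (\<lambda>z. y (z, i)) (\<lambda>z. y (z, i))))" .
    qed
  qed (use KB insert.IH[OF KS] in auto)
  note row = this
  have lim: "(\<lambda>n. v n p) \<longlonglongrightarrow> \<Phi> p" for p
  proof -
    have "(\<lambda>n. v n p) \<longlonglongrightarrow> of_real 1 * \<Phi> p"
      unfolding v_def by (intro tendsto_intros LIMSEQ_n_over_Suc_n)
    then show ?thesis by simp
  qed
  show ?case 
    by (rule psd_limit[where F = "\<lambda>n z w. K z w * (1 - (\<Sum>i<N. v n (z, i) * cnj (v n (w, i))))", OF row])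
      (intro tendsto_intros lim)
qed

section \<open>Kernel matrices and multiplication operators\<close>

lemma sum_sqrt_mult_le:
  assumes "\<And>i. i \<in> A \<Longrightarrow> 0 \<le> f i" "\<And>i. i \<in> A \<Longrightarrow> 0 \<le> g i"
  shows "(\<Sum>i\<in>A. sqrt (f i) * sqrt (g i)) \<le> sqrt (\<Sum>i\<in>A. f i) * sqrt (\<Sum>i\<in>A. g i)"
proof -
  have "(\<Sum>i\<in>A. sqrt (f i) * sqrt (g i)) = (\<Sum>i\<in>A. \<bar>sqrt (f i)\<bar> * \<bar>sqrt (g i)\<bar>)"
    using assms by (intro sum.cong) auto
  also have "\<dots> \<le> L2_set (\<lambda>i. sqrt (f i)) A * L2_set (\<lambda>i. sqrt (g i)) A"
    by (rule L2_set_mult_ineq)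
  also have "\<dots> = sqrt (\<Sum>i\<in>A. f i) * sqrt (\<Sum>i\<in>A. g i)"
    unfolding L2_set_def using assms by (intro arg_cong2[where f = "(*)"] arg_cong[where f = sqrt] sum.cong) auto
  finally show ?thesis .
qed

section \<open>Squared norms and finite sums\<close>

context inner_product_function_space
begin

definition sqnorm :: "('x \<Rightarrow> complex) \<Rightarrow> real"
  where "sqnorm f = Re (ip f f)"

lemma sqnorm_nonneg: "f \<in> H \<Longrightarrow> 0 \<le> sqnorm f"
  by (simp add: sqnorm_def ip_nonneg)

lemma ip_scale_right: "\<lbrakk>f \<in> H; h \<in> H\<rbrakk> \<Longrightarrow> ip h (\<lambda>x. c * f x) = cnj c * ip h f"
  by (simp add: ip_cnj[of "\<lambda>x. c * f x" h] ip_cnj[of f h] scale_mem ip_scale)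

lemma ip_zero: "f \<in> H \<Longrightarrow> ip (\<lambda>x. 0) f = 0"
  using ip_scale[of "\<lambda>x. 0" f 0] zero_mem by simp

lemma sum_mem: "(\<And>i. i \<in> A \<Longrightarrow> f i \<in> H) \<Longrightarrow> (\<lambda>x. \<Sum>i\<in>A. f i x) \<in> H"
  by (induction A rule: infinite_finite_induct) (simp_all add: zero_mem add_mem)

lemma ip_sum:
  "(\<And>i. i \<in> A \<Longrightarrow> f i \<in> H) \<Longrightarrow> h \<in> H \<Longrightarrow> ip (\<lambda>x. \<Sum>i\<in>A. f i x) h = (\<Sum>i\<in>A. ip (f i) h)"
  by (induction A rule: infinite_finite_induct) (simp_all add: ip_zero ip_add sum_mem)

lemma sqnorm_scale: "f \<in> H \<Longrightarrow> sqnorm (\<lambda>x. c * f x) = (cmod c)\<^sup>2 * sqnorm f"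
proof -
  assume f: "f \<in> H"
  have "ip (\<lambda>x. c * f x) (\<lambda>x. c * f x) = (c * cnj c) * ip f f"
    using f by (simp add: ip_scale ip_scale_right scale_mem)
  then show ?thesis unfolding sqnorm_def complex_norm_square[symmetric] by simp
qed

lemma sqnorm_add:
  assumes "f \<in> H" "g \<in> H"
  shows "sqnorm (\<lambda>x. f x + g x) = sqnorm f + 2 * Re (ip f g) + sqnorm g"
  using ip_self_add_scale[OF assms, of 1] by (simp add: sqnorm_def)

lemma sqnorm_diff:
  assumes "f \<in> H" "g \<in> H"
  shows "sqnorm (\<lambda>x. f x - g x) = sqnorm f - 2 * Re (ip f g) + sqnorm g"
  using ip_self_add_scale[OF assms, of "-1"] by (simp add: sqnorm_def)

lemma sqnorm_zero: "f \<in> H \<Longrightarrow> sqnorm f = 0 \<Longrightarrow> f = (\<lambda>x. 0)"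
  using ip_cnj[of f f] ip_definite[of f] by (simp add: sqnorm_def complex_eq_iff)

lemma Re_ip_le: "f \<in> H \<Longrightarrow> g \<in> H \<Longrightarrow> Re (ip f g) \<le> sqrt (sqnorm f) * sqrt (sqnorm g)"
  unfolding sqnorm_def by (rule Re_ip_Cauchy_Schwarz)

lemma ip_dist_sqnorm: "f \<in> H \<Longrightarrow> g \<in> H \<Longrightarrow> ip_dist H ip f g = sqrt (sqnorm (\<lambda>x. f x - g x))"
  by (simp add: ip_dist_def sqnorm_def)

end

section \<open>Combinations of kernel functions and their density\<close>

context separable_rkhs
begin

lemma kernel_cnj: "K w z = cnj (K z w)"
  using ip_cnj[OF kernel_mem kernel_mem, of w z] reproducing[OF kernel_mem, of w z]
    reproducing[OF kernel_mem, of z w] by simp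

text \<open>Conjugated coefficients make pairing with \<open>comb Y y\<close> linear in
  \<open>y\<close> and its squared norm equal to the form of \<open>K\<close> at
  \<open>y\<close>.\<close>

definition comb :: "'x set \<Rightarrow> ('x \<Rightarrow> complex) \<Rightarrow> 'x \<Rightarrow> complex"
  where "comb Y y = (\<lambda>z. \<Sum>w\<in>Y. cnj (y w) * K z w)"

lemma comb_mem: "comb Y y \<in> H"
  unfolding comb_def by (intro sum_mem scale_mem kernel_mem)

lemma ip_comb: "f \<in> H \<Longrightarrow> ip f (comb Y y) = (\<Sum>w\<in>Y. y w * f w)"
proof -
  assume f: "f \<in> H"
  have "ip (comb Y y) f = (\<Sum>w\<in>Y. cnj (y w) * cnj (f w))"
    unfolding comb_def using f
    by (simp add: ip_sum scale_mem kernel_mem ip_scale ip_cnj[OF f kernel_mem] reproducing)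
  then show ?thesis using ip_cnj[OF comb_mem f, of Y y] by simp
qed

lemma sqnorm_comb: "sqnorm (comb Y y) = Re (sesq Y K y y)"
  unfolding sqnorm_def ip_comb[OF comb_mem]
  by (simp add: sesq_def comb_def sum_distrib_left mult.assoc)

lemma psd_kernel: "psd Y K"
proof (rule psdI)
  show "0 \<le> Re (sesq Y K y y)" for y
    unfolding sqnorm_comb[symmetric] by (rule sqnorm_nonneg[OF comb_mem])
qed (rule kernel_cnj)

lemma evaluation_bound:
  assumes f: "f \<in> H"
  shows "(cmod (f w))\<^sup>2 \<le> sqnorm f * Re (K w w)"
proof (cases "f w = 0")
  case True
  then show ?thesis
    using sqnorm_nonneg[OF f] psd_diag(1)[OF psd_kernel, of "{w}" w] by simp
next
  case False
  have k: "ip (\<lambda>z. K z w) (\<lambda>z. K z w) = K w w" by (rule reproducing[OF kernel_mem])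
  \<comment> \<open>Only real parts are controlled by Cauchy-Schwarz; this scalar makes the value at
    \<open>w\<close> real and nonnegative.\<close>
  have "cnj (f w) * f w = of_real ((cmod (f w))\<^sup>2)"
    unfolding complex_norm_square by (rule mult.commute)
  then have "(cmod (f w))\<^sup>2 = Re (ip (\<lambda>x. cnj (f w) * f x) (\<lambda>z. K z w))"
    using f by (simp add: ip_scale kernel_mem reproducing)
  also have "\<dots> \<le> sqrt ((cmod (f w))\<^sup>2 * sqnorm f) * sqrt (Re (K w w))"
    using Re_ip_le[OF scale_mem[OF f, of "cnj (f w)"] kernel_mem[of w]] sqnorm_scale[OF f, of "cnj (f w)"]
    by (simp add: sqnorm_def[of "\<lambda>z. K z w"] k)
  also have "\<dots> = cmod (f w) * sqrt (sqnorm f * Re (K w w))"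
    by (simp add: real_sqrt_mult)
  finally have "cmod (f w) \<le> sqrt (sqnorm f * Re (K w w))"
    using False by (simp add: power2_eq_square)
  then have "(cmod (f w))\<^sup>2 \<le> (sqrt (sqnorm f * Re (K w w)))\<^sup>2" by (intro power_mono) auto
  moreover have "0 \<le> sqnorm f * Re (K w w)"
    using sqnorm_nonneg[OF f] psd_diag(1)[OF psd_kernel, of "{w}" w] by simp
  ultimately show ?thesis by simp
qed

lemma comb_add_scale:
  assumes "finite Y" "finite Z"
  obtains W y where "finite W" "comb W y = (\<lambda>z. a * comb Y u z + b * comb Z v z)"
proof
  show "finite (Y \<union> Z)" using assms by simp
  have 1: "comb Y u = (\<lambda>z. \<Sum>w\<in>Y \<union> Z. (if w \<in> Y then cnj (u w) else 0) * K z w)"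
    unfolding comb_def using assms by (intro ext sum.mono_neutral_cong_left) auto
  have 2: "comb Z v = (\<lambda>z. \<Sum>w\<in>Y \<union> Z. (if w \<in> Z then cnj (v w) else 0) * K z w)"
    unfolding comb_def using assms by (intro ext sum.mono_neutral_cong_left) auto
  show "comb (Y \<union> Z) (\<lambda>w. cnj a * (if w \<in> Y then u w else 0) + cnj b * (if w \<in> Z then v w else 0)) =
      (\<lambda>z. a * comb Y u z + b * comb Z v z)"
    unfolding 1 2 by (auto simp: comb_def sum_distrib_left sum.distrib[symmetric] algebra_simps intro!: sum.cong)
qed

text \<open>A sequence minimising the distance to \<open>g\<close> converges by completeness.
  Near-minimality makes its residuals almost orthogonal to every kernel function, so their values
  tend to 0 at each point and the limit is \<open>g\<close>.\<close>

lemma kernel_span_dense: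
  assumes g: "g \<in> H" and e: "0 < e"
  obtains Y y where "finite Y" "sqnorm (\<lambda>z. g z - comb Y y z) < e"
proof -
  define V where "V = {comb Y y | Y y. finite Y}"
  have VH: "p \<in> H" if "p \<in> V" for p using that comb_mem by (auto simp: V_def)
  have V0: "comb {} (\<lambda>_. 0) \<in> V" by (auto simp: V_def)
  have Vlin: "(\<lambda>z. a * p z + b * q z) \<in> V" if "p \<in> V" "q \<in> V" for p q a b
  proof -
    obtain Y u where Y: "finite Y" "p = comb Y u"
      using \<open>p \<in> V\<close> unfolding V_def by (elim CollectE exE conjE)
    obtain Z v where Z: "finite Z" "q = comb Z v"
      using \<open>q \<in> V\<close> unfolding V_def by (elim CollectE exE conjE)
    obtain W y where "finite W" "comb W y = (\<lambda>z. a * comb Y u z + b * comb Z v z)"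
      by (rule comb_add_scale[OF Y(1) Z(1)])
    then have "\<exists>W y. (\<lambda>z. a * p z + b * q z) = comb W y \<and> finite W"
      unfolding Y(2) Z(2) by (intro exI[of _ W] exI[of _ y]) simp
    then show ?thesis unfolding V_def mem_Collect_eq .
  qed
  have kV: "(\<lambda>z. K z w) \<in> V" for w
  proof -
    have "(\<lambda>z. K z w) = comb {w} (\<lambda>_. 1)" by (simp add: comb_def)
    then show ?thesis unfolding V_def by blast
  qed
  have gp: "(\<lambda>z. g z - p z) \<in> H" if "p \<in> V" for p using diff_mem[OF g VH[OF that]] .
  define D where "D = (\<lambda>p. sqnorm (\<lambda>z. g z - p z)) ` V"
  define d where "d = Inf D"
  have bdd: "bdd_below D" unfolding D_def by (rule bdd_belowI2[of _ 0]) (rule sqnorm_nonneg[OF gp])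
  have d_le: "d \<le> sqnorm (\<lambda>z. g z - p z)" if "p \<in> V" for p
    unfolding d_def by (rule cInf_lower[OF _ bdd]) (use that in \<open>auto simp: D_def\<close>)
  have "\<exists>p\<in>V. sqnorm (\<lambda>z. g z - p z) < d + inverse (real (Suc n))" for n
    using cInf_lessD[of D "d + inverse (real (Suc n))"] V0 by (auto simp: D_def d_def)
  then obtain p where pV: "\<And>n. p n \<in> V" and p: "\<And>n. sqnorm (\<lambda>z. g z - p n z) < d + inverse (real (Suc n))"
    by metis
  note pH = VH[OF pV]
  \<comment> \<open>Parallelogram law: the midpoint of two members of \<open>V\<close> is again in
    \<open>V\<close>, hence at squared distance at least \<open>d\<close> from
    \<open>g\<close>.\<close>
  have par: "sqnorm (\<lambda>z. p m z - p n z) \<le> 2 * inverse (real (Suc m)) + 2 * inverse (real (Suc n))" for m n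
  proof -
    define u v where "u = (\<lambda>z. g z - p n z)" and "v = (\<lambda>z. g z - p m z)"
    have u: "u \<in> H" and v: "v \<in> H" unfolding u_def v_def by (intro gp pV)+
    have "(\<lambda>z. u z - v z) = (\<lambda>z. p m z - p n z)" by (auto simp: u_def v_def)
    moreover have "(\<lambda>z. u z + v z) = (\<lambda>z. 2 * (g z - (1/2 * p m z + 1/2 * p n z)))"
      by (auto simp: u_def v_def)
    moreover have "sqnorm (\<lambda>z. 2 * (g z - (1/2 * p m z + 1/2 * p n z))) \<ge> 4 * d"
      using sqnorm_scale[OF gp[OF Vlin[OF pV[of m] pV[of n]]], of 2 "1/2" "1/2"]
        d_le[OF Vlin[OF pV[of m] pV[of n]], of "1/2" "1/2"] by simp
    ultimately show ?thesis
      using sqnorm_add[OF u v] sqnorm_diff[OF u v] p[of m] p[of n] by (simp add: u_def v_def)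
  qed
  interpret M: Metric_space H "ip_dist H ip" by (rule Metric_space_ip_dist)
  have "M.MCauchy p"
    unfolding M.MCauchy_def
  proof (intro conjI allI impI)
    fix r :: real assume r: "0 < r"
    obtain n0 where n0: "inverse (real (Suc n0)) < r\<^sup>2 / 4"
      using reals_Archimedean[of "r\<^sup>2 / 4"] r by auto
    have "ip_dist H ip (p m) (p n) < r" if "n0 \<le> m" "n0 \<le> n" for m n
    proof -
      have "inverse (real (Suc m)) \<le> inverse (real (Suc n0))" "inverse (real (Suc n)) \<le> inverse (real (Suc n0))"
        using that by (simp_all add: le_imp_inverse_le)
      then have "sqnorm (\<lambda>z. p m z - p n z) < r\<^sup>2" using par[of m n] n0 by linarith
      then show ?thesis unfolding ip_dist_sqnorm[OF pH pH]
        using r real_less_lsqrt sqnorm_nonneg[OF diff_mem[OF pH pH]] by (simp add: real_sqrt_less_iff real_less_lsqrt)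
    qed
    then show "\<exists>N. \<forall>n n'. N \<le> n \<longrightarrow> N \<le> n' \<longrightarrow> ip_dist H ip (p n) (p n') < r" by blast
  qed (use pH in blast)
  then obtain q where lim: "limitin M.mtopology p q sequentially"
    using complete unfolding M.mcomplete_def by blast
  then have qH: "q \<in> H" and conv: "\<And>r. 0 < r \<Longrightarrow> \<exists>N. \<forall>n\<ge>N. ip_dist H ip (p n) q < r"
    unfolding M.limit_metric_sequentially by blast+
  have conv': "\<exists>N. \<forall>n\<ge>N. sqnorm (\<lambda>z. q z - p n z) < r" if r: "0 < r" for r
  proof -
    obtain N where N: "\<forall>n\<ge>N. ip_dist H ip (p n) q < sqrt r" using conv[of "sqrt r"] r by auto
    have "sqnorm (\<lambda>z. q z - p n z) < r" if "n \<ge> N" for n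
      using N[rule_format, OF that] ip_dist_sqnorm[OF qH pH, of n] M.commute[of "p n" q] by simp
    then show ?thesis by blast
  qed
  have "g w = q w" for w
  proof -
    define \<kappa> where "\<kappa> = Re (K w w)"
    have \<kappa>: "0 \<le> \<kappa>" using psd_diag(1)[OF psd_kernel, of "{w}" w] by (simp add: \<kappa>_def)
    have 1: "(cmod (g w - p n w))\<^sup>2 \<le> (1 + \<kappa>) * inverse (real (Suc n))" for n
    proof -
      define f where "f = (\<lambda>z. g z - p n z)"
      \<comment> \<open>The optimal multiple of the kernel function would divide by
        \<open>\<kappa>\<close>; \<open>1 + \<kappa>\<close> covers \<open>\<kappa> = 0\<close> as
        well and costs only a constant factor.\<close>
      define c where "c = complex_of_real (1 / (1 + \<kappa>)) * f w"
      have f: "f \<in> H" unfolding f_def by (rule gp[OF pV])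
      define h where "h = (\<lambda>z. c * K z w)"
      have h: "h \<in> H" unfolding h_def by (intro scale_mem kernel_mem)
      have "ip f h = of_real (1 / (1 + \<kappa>)) * (f w * cnj (f w))"
        unfolding h_def ip_scale_right[OF kernel_mem f] reproducing[OF f] c_def by simp
      then have "Re (ip f h) = (cmod (f w))\<^sup>2 / (1 + \<kappa>)"
        unfolding complex_norm_square[symmetric] of_real_mult[symmetric] by simp
      moreover have "sqnorm h = (cmod (f w))\<^sup>2 / (1 + \<kappa>)\<^sup>2 * \<kappa>"
      proof -
        have "cmod c = cmod (f w) / (1 + \<kappa>)" unfolding c_def norm_mult norm_of_real using \<kappa> by simp
        then show ?thesis
          unfolding h_def sqnorm_scale[OF kernel_mem]
          by (simp add: sqnorm_def reproducing[OF kernel_mem] \<kappa>_def power_divide)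
      qed
      moreover have "d \<le> sqnorm (\<lambda>z. f z - h z)"
        using d_le[OF Vlin[OF pV[of n] kV[of w]], of 1 c] by (simp add: f_def h_def algebra_simps)
      moreover have "sqnorm f < d + inverse (real (Suc n))" unfolding f_def by (rule p)
      ultimately have "2 * ((cmod (f w))\<^sup>2 / (1 + \<kappa>)) - (cmod (f w))\<^sup>2 / (1 + \<kappa>)\<^sup>2 * \<kappa> \<le> inverse (real (Suc n))"
        using sqnorm_diff[OF f h] by simp
      moreover have "(cmod (f w))\<^sup>2 / (1 + \<kappa>)\<^sup>2 * \<kappa> \<le> (cmod (f w))\<^sup>2 / (1 + \<kappa>)"
      proof -
        have "(cmod (f w))\<^sup>2 / (1 + \<kappa>) * (\<kappa> / (1 + \<kappa>)) \<le> (cmod (f w))\<^sup>2 / (1 + \<kappa>) * 1"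
          using \<kappa> by (intro mult_left_mono) auto
        then show ?thesis by (simp add: power2_eq_square)
      qed
      ultimately have "(cmod (f w))\<^sup>2 / (1 + \<kappa>) \<le> inverse (real (Suc n))" by simp
      then show ?thesis using \<kappa> by (simp add: f_def field_simps)
    qed
    have "(\<lambda>n. (cmod (g w - p n w))\<^sup>2) \<longlonglongrightarrow> 0"
    proof (rule tendsto_sandwich[OF _ _ tendsto_const])
      show "(\<lambda>n. (1 + \<kappa>) * inverse (real (Suc n))) \<longlonglongrightarrow> 0"
        using tendsto_mult_right_zero[OF LIMSEQ_inverse_real_of_nat, of "1 + \<kappa>"] by simp
    qed (use 1 in auto)
    then have "(\<lambda>n. cmod (g w - p n w)) \<longlonglongrightarrow> 0"
      using tendsto_real_sqrt[of "\<lambda>n. (cmod (g w - p n w))\<^sup>2" 0] by simp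
    then have g': "(\<lambda>n. p n w) \<longlonglongrightarrow> g w"
      by (simp add: tendsto_norm_zero_iff LIM_zero_iff tendsto_iff dist_norm norm_minus_commute)
    have "(\<lambda>n. p n w) \<longlonglongrightarrow> q w"
    proof (rule LIMSEQ_I)
      fix r :: real assume r: "0 < r"
      obtain N where N: "\<forall>n\<ge>N. sqnorm (\<lambda>z. q z - p n z) < r\<^sup>2 / (1 + \<kappa>)"
        using conv'[of "r\<^sup>2 / (1 + \<kappa>)"] r \<kappa> by auto
      have "norm (p n w - q w) < r" if "n \<ge> N" for n
      proof -
        have "(cmod (q w - p n w))\<^sup>2 \<le> sqnorm (\<lambda>z. q z - p n z) * \<kappa>"
          unfolding \<kappa>_def by (rule evaluation_bound[OF diff_mem[OF qH pH]])
        also have "\<dots> \<le> sqnorm (\<lambda>z. q z - p n z) * (1 + \<kappa>)"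
          by (intro mult_left_mono sqnorm_nonneg diff_mem qH pH) simp
        also have "\<dots> < r\<^sup>2" using N that \<kappa> by (simp add: field_simps)
        finally show ?thesis using r by (simp add: norm_minus_commute power_less_imp_less_base)
      qed
      then show "\<exists>N. \<forall>n\<ge>N. norm (p n w - q w) < r" by blast
    qed
    then show ?thesis using g' LIMSEQ_unique by blast
  qed
  then have "g = q" by auto
  then obtain n where "sqnorm (\<lambda>z. g z - p n z) < e" using conv'[OF e] by blast
  then show ?thesis using pV[of n] that by (auto simp: V_def)
qed

end

section \<open>Operator bounds and positivity of kernel matrices\<close>

context separable_rkhs
begin

text \<open>Here \<open>f\<close> is the adjoint applied to the tuple \<open>g\<close>, so its
  squared norm is the pairing of the column times \<open>f\<close> with \<open>g\<close>.
  Cauchy-Schwarz and the bound on the column leave one factor of the norm of \<open>f\<close> to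
  cancel.\<close>

lemma psd_of_column_bound:
  assumes mem: "\<And>k f. k < n \<Longrightarrow> f \<in> H \<Longrightarrow> (\<lambda>x. \<Phi> k x * f x) \<in> H"
    and bound: "\<And>f. f \<in> H \<Longrightarrow> (\<Sum>k<n. sqnorm (\<lambda>x. \<Phi> k x * f x)) \<le> sqnorm f"
  shows "psd (Y \<times> {..<n}) (column_kernel K K (\<lambda>p. \<Phi> (snd p) (fst p)))"
  unfolding psd_column_kernel_iff[OF psd_kernel psd_kernel] fst_conv snd_conv
proof
  fix y :: "'x \<times> nat \<Rightarrow> complex"
  define s where "s z = (\<Sum>i<n. y (z, i) * \<Phi> i z)" for z
  define f where "f = comb Y s"
  define g where "g k = comb Y (\<lambda>z. y (z, k))" for k
  have f: "f \<in> H" and g: "g k \<in> H" for k unfolding f_def g_def by (rule comb_mem)+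
  define \<Lambda> where "\<Lambda> = (\<Sum>k<n. sqnorm (g k))"
  have "ip f f = (\<Sum>w\<in>Y. s w * f w)" unfolding f_def by (rule ip_comb[OF comb_mem])
  also have "\<dots> = (\<Sum>k<n. \<Sum>w\<in>Y. y (w, k) * (\<Phi> k w * f w))"
    unfolding s_def by (simp add: sum_distrib_right mult.assoc sum.swap[of _ Y])
  also have "\<dots> = (\<Sum>k<n. ip (\<lambda>x. \<Phi> k x * f x) (g k))"
    unfolding g_def by (intro sum.cong refl) (simp add: ip_comb mem f)
  finally have "sqnorm f = (\<Sum>k<n. Re (ip (\<lambda>x. \<Phi> k x * f x) (g k)))"
    by (simp add: sqnorm_def)
  also have "\<dots> \<le> (\<Sum>k<n. sqrt (sqnorm (\<lambda>x. \<Phi> k x * f x)) * sqrt (sqnorm (g k)))"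
    by (intro sum_mono Re_ip_le mem f g) auto
  also have "\<dots> \<le> sqrt (\<Sum>k<n. sqnorm (\<lambda>x. \<Phi> k x * f x)) * sqrt \<Lambda>"
    unfolding \<Lambda>_def by (intro sum_sqrt_mult_le sqnorm_nonneg mem f g) auto
  also have "\<dots> \<le> sqrt (sqnorm f) * sqrt \<Lambda>"
    using bound[OF f] by (intro mult_right_mono) (auto simp: \<Lambda>_def intro!: sum_nonneg sqnorm_nonneg g)
  finally have le: "sqnorm f \<le> sqrt (sqnorm f) * sqrt \<Lambda>" .
  have "sqnorm f \<le> \<Lambda>"
  proof (cases "sqnorm f = 0")
    case True
    then show ?thesis by (simp add: \<Lambda>_def sum_nonneg sqnorm_nonneg g)
  next
    case False
    then have pos: "0 < sqnorm f" using sqnorm_nonneg[OF f] by simp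
    have "sqrt (sqnorm f) * sqrt (sqnorm f) \<le> sqrt (sqnorm f) * sqrt \<Lambda>"
      unfolding real_sqrt_mult_self using le pos by linarith
    then have "sqrt (sqnorm f) \<le> sqrt \<Lambda>" by (rule mult_left_le_imp_le) (use pos in simp)
    then show ?thesis by simp
  qed
  then show "Re (sesq Y K (\<lambda>z. \<Sum>i<n. y (z, i) * \<Phi> i z) (\<lambda>z. \<Sum>i<n. y (z, i) * \<Phi> i z))
      \<le> (\<Sum>i<n. Re (sesq Y K (\<lambda>z. y (z, i)) (\<lambda>z. y (z, i))))"
    unfolding \<Lambda>_def g_def f_def sqnorm_comb s_def .
qed

lemma kernel_span_dense_finite:
  assumes g: "\<And>i. i < (M::nat) \<Longrightarrow> g i \<in> H" and e: "0 < e"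
  obtains Y y where "finite Y" "\<And>i. i < M \<Longrightarrow> sqnorm (\<lambda>z. g i z - comb Y (y i) z) < e"
proof -
  have "\<exists>Y y. finite Y \<and> sqnorm (\<lambda>z. g i z - comb Y y z) < e" if "i < M" for i
    using kernel_span_dense[OF g[OF that] e] by metis
  then obtain Y y where Y: "\<And>i. i < M \<Longrightarrow> finite (Y i)"
    and y: "\<And>i. i < M \<Longrightarrow> sqnorm (\<lambda>z. g i z - comb (Y i) (y i) z) < e"
    by metis
  show ?thesis
  proof
    show fin: "finite (\<Union>i<M. Y i)" using Y by simp
    fix i assume i: "i < M"
    have "comb (\<Union>i<M. Y i) (\<lambda>w. if w \<in> Y i then y i w else 0) = comb (Y i) (y i)"
      unfolding comb_def using i fin by (intro ext sum.mono_neutral_cong_right) auto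
    then show "sqnorm (\<lambda>z. g i z - comb (\<Union>i<M. Y i) (\<lambda>w. if w \<in> Y i then y i w else 0) z) < e"
      using y[OF i] by simp
  qed
qed

text \<open>Only the image components \<open>g i\<close> are approximated by kernel combinations.
  Pairing the images with these combinations moves the matrix to its adjoint, whose contractivity is
  the assumed positivity, so no boundedness of the matrix is presupposed.\<close>

lemma bound_of_psd_matrix:
  fixes M N :: nat
  assumes psd: "\<And>Y. finite Y \<Longrightarrow> psd (Y \<times> {..<M}) (\<lambda>p q. of_bool (snd p = snd q) * K (fst p) (fst q)
      - K (fst p) (fst q) * (\<Sum>j<N. \<phi> (snd p) j (fst p) * cnj (\<phi> (snd q) j (fst q))))"
    and F: "\<And>j. j < N \<Longrightarrow> F j \<in> H"
    and mem: "\<And>i. i < M \<Longrightarrow> (\<lambda>z. \<Sum>j<N. \<phi> i j z * F j z) \<in> H"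
  shows "(\<Sum>i<M. sqnorm (\<lambda>z. \<Sum>j<N. \<phi> i j z * F j z)) \<le> (\<Sum>j<N. sqnorm (F j))"
proof (rule field_le_epsilon)
  fix e :: real assume e: "0 < e"
  define c where "c = (\<Sum>j<N. sqnorm (F j))"
  define g where "g i = (\<lambda>z. \<Sum>j<N. \<phi> i j z * F j z)" for i
  have g: "g i \<in> H" if "i < M" for i unfolding g_def by (rule mem[OF that])
  have "0 < e / real (Suc M)" using e by simp
  then obtain Y y where Y: "finite Y" and y: "\<And>i. i < M \<Longrightarrow> sqnorm (\<lambda>z. g i z - comb Y (y i) z) < e / real (Suc M)"
    using kernel_span_dense_finite[where M = M and g = g and e = "e / real (Suc M)", OF g] by metis
  define P where "P = (\<Sum>i<M. sqnorm (comb Y (y i)))"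
  define x where "x j z = (\<Sum>i<M. y i z * \<phi> i j z)" for j z
  have xP: "(\<Sum>j<N. sqnorm (comb Y (x j))) \<le> P"
  proof -
    let ?y = "\<lambda>p. y (snd p) (fst p)"
    have "sesq (Y \<times> {..<M}) (\<lambda>p q. K (fst p) (fst q) * (\<Sum>j<N. \<phi> (snd p) j (fst p) * cnj (\<phi> (snd q) j (fst q)))) ?y ?y
        = (\<Sum>j<N. sesq Y K (x j) (x j))"
      unfolding sum_distrib_left sesq_sum x_def
      by (intro sum.cong refl) (simp add: sesq_block_outer[of Y M K "\<lambda>p. \<phi> (snd p) j (fst p)" for j])
    then have "0 \<le> (\<Sum>i<M. Re (sesq Y K (y i) (y i))) - (\<Sum>j<N. Re (sesq Y K (x j) (x j)))"
      using psd_nonneg[OF psd[OF Y], of ?y] unfolding sesq_diff sesq_block_diagonal[of Y M K] by simp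
    then show ?thesis by (simp add: P_def sqnorm_comb)
  qed
  have "(\<Sum>i<M. Re (ip (g i) (comb Y (y i)))) = Re (\<Sum>i<M. \<Sum>w\<in>Y. y i w * g i w)"
    by (simp add: ip_comb g)
  also have "(\<Sum>i<M. \<Sum>w\<in>Y. y i w * g i w) = (\<Sum>i<M. \<Sum>j<N. \<Sum>w\<in>Y. y i w * (\<phi> i j w * F j w))"
    unfolding g_def sum_distrib_left by (intro sum.cong refl sum.swap)
  also have "\<dots> = (\<Sum>j<N. \<Sum>i<M. \<Sum>w\<in>Y. y i w * (\<phi> i j w * F j w))" by (rule sum.swap)
  also have "\<dots> = (\<Sum>j<N. \<Sum>w\<in>Y. \<Sum>i<M. y i w * (\<phi> i j w * F j w))" by (intro sum.cong refl sum.swap)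
  also have "\<dots> = (\<Sum>j<N. ip (F j) (comb Y (x j)))"
    by (intro sum.cong refl) (simp add: ip_comb F x_def sum_distrib_right mult.assoc)
  also have "Re \<dots> = (\<Sum>j<N. Re (ip (F j) (comb Y (x j))))" by simp
  also have "\<dots> \<le> (\<Sum>j<N. sqrt (sqnorm (F j)) * sqrt (sqnorm (comb Y (x j))))"
    by (intro sum_mono Re_ip_le F comb_mem) auto
  also have "\<dots> \<le> sqrt c * sqrt (\<Sum>j<N. sqnorm (comb Y (x j)))"
    unfolding c_def by (intro sum_sqrt_mult_le sqnorm_nonneg F comb_mem) auto
  also have "\<dots> \<le> sqrt c * sqrt P"
    using xP by (intro mult_left_mono) (auto simp: c_def intro!: sum_nonneg sqnorm_nonneg F)
  \<comment> \<open>The arithmetic-geometric mean leaves a multiple of \<open>P\<close> that cancels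
    the squared norms of the approximants at the end.\<close>
  also have "\<dots> \<le> (c + P) / 2"
  proof -
    have "0 \<le> c" "0 \<le> P" unfolding c_def P_def by (intro sum_nonneg sqnorm_nonneg F comb_mem; simp)+
    then show ?thesis using arith_geo_mean_sqrt[of c P] by (simp add: real_sqrt_mult)
  qed
  finally have le: "(\<Sum>i<M. Re (ip (g i) (comb Y (y i)))) \<le> (c + P) / 2" .
  have "(\<Sum>i<M. sqnorm (g i) - 2 * Re (ip (g i) (comb Y (y i))) + sqnorm (comb Y (y i))) \<le> (\<Sum>i<M. e / real (Suc M))"
  proof (rule sum_mono)
    fix i assume "i \<in> {..<M}"
    then show "sqnorm (g i) - 2 * Re (ip (g i) (comb Y (y i))) + sqnorm (comb Y (y i)) \<le> e / real (Suc M)"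
      using y[of i] sqnorm_diff[OF g comb_mem, of i Y "y i"] by simp
  qed
  also have "\<dots> \<le> e" using e by (simp add: field_simps)
  finally have "(\<Sum>i<M. sqnorm (g i)) - 2 * (\<Sum>i<M. Re (ip (g i) (comb Y (y i)))) + P \<le> e"
    by (simp add: P_def sum.distrib sum_subtractf sum_distrib_left)
  then show "(\<Sum>i<M. sqnorm (\<lambda>z. \<Sum>j<N. \<phi> i j z * F j z)) \<le> (\<Sum>j<N. sqnorm (F j)) + e"
    using le by (simp add: c_def g_def)
qed

end

text \<open>Partial sums of the inner product are sums of rank-one kernels, so positivity is
  preserved in the limit. The strict bound keeps \<open>1 - B\<close> nonzero, also off the
  diagonal.\<close>

lemma unit_ball_gram:
  assumes b: "range b \<subseteq> unit_ball d"
  defines "B \<equiv> (\<lambda>z w. \<Sum>n. b z n * cnj (b w n))"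
  shows "psd Y B" "cmod (B z w) < 1"
proof -
  have sq: "summable (\<lambda>n. (cmod (b z n))\<^sup>2)" and lt: "(\<Sum>n. (cmod (b z n))\<^sup>2) < 1" for z
    using b by (auto simp: unit_ball_def)
  have sm: "summable (\<lambda>n. b z n * cnj (b w n))" for z w
  proof (rule summable_comparison_test'[where N = 0])
    show "summable (\<lambda>n. (cmod (b z n))\<^sup>2 + (cmod (b w n))\<^sup>2)" by (intro summable_add sq)
    show "norm (b z n * cnj (b w n)) \<le> (cmod (b z n))\<^sup>2 + (cmod (b w n))\<^sup>2" for n
    proof -
      have "0 \<le> cmod (b z n) * cmod (b w n)" by simp
      then show ?thesis
        using sum_squares_bound[of "cmod (b z n)" "cmod (b w n)"] unfolding norm_mult complex_mod_cnj
        by linarith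
    qed
  qed
  have part: "psd Y (\<lambda>z w. \<Sum>k<n. b z k * cnj (b w k))" for n Y
  proof (induction n)
    case 0
    then show ?case by (simp add: psd_def sesq_def)
  next
    case (Suc n)
    show ?case using psd_add[OF Suc psd_outer[of Y "\<lambda>z. b z n"]] by simp
  qed
  have psd: "psd Y B" for Y
    unfolding B_def by (rule psd_limit[OF part]) (rule summable_LIMSEQ[OF sm])
  then show "psd Y B" .
  have diag: "Re (B z z) < 1" "0 \<le> Re (B z z)" for z
  proof -
    have "B z z = (\<Sum>n. complex_of_real ((cmod (b z n))\<^sup>2))"
      unfolding B_def complex_norm_square ..
    also have "\<dots> = of_real (\<Sum>n. (cmod (b z n))\<^sup>2)" by (rule suminf_of_real[OF sq, symmetric])
    finally show "Re (B z z) < 1" using lt[of z] by simp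
    show "0 \<le> Re (B z z)" using psd_diag(1)[OF psd, of "{z}" z] by simp
  qed
  have "(cmod (B z w))\<^sup>2 \<le> Re (B z z) * Re (B w w)"
    using psd_entry_bound[OF psd, of "{z, w}" z w] by simp
  also have "\<dots> < 1 * 1" using diag by (intro mult_strict_mono') auto
  finally show "cmod (B z w) < 1" by (simp add: power_less_one_iff)
qed

section \<open>The matrix bound in complete Pick spaces\<close>

context normalized_complete_pick_space
begin

lemma matrix_bound:
  fixes M N :: nat
  assumes mem: "\<And>i j f. i < M \<Longrightarrow> j < N \<Longrightarrow> f \<in> H \<Longrightarrow> (\<lambda>x. \<phi> i j x * f x) \<in> H"
    and bound: "\<And>f. f \<in> H \<Longrightarrow> (\<Sum>k<N * M. sqnorm (\<lambda>x. \<phi> (k mod M) (k div M) x * f x)) \<le> sqnorm f"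
    and F: "\<And>j. j < N \<Longrightarrow> F j \<in> H"
  shows "(\<Sum>i<M. sqnorm (\<lambda>z. \<Sum>j<N. \<phi> i j z * F j z)) \<le> (\<Sum>j<N. sqnorm (F j))"
proof (rule bound_of_psd_matrix)
  show "F j \<in> H" if "j < N" for j using that by (rule F)
  show "(\<lambda>z. \<Sum>j<N. \<phi> i j z * F j z) \<in> H" if "i < M" for i
    using that by (intro sum_mem mem F) auto
next
  fix Y :: "'x set" assume Y: "finite Y"
  obtain d b where b: "range b \<subseteq> unit_ball d" and Kb: "\<And>z w. K z w = 1 / (1 - (\<Sum>n. b z n * cnj (b w n)))"
    using ball_embedding by blast
  define B where "B = (\<lambda>z w. \<Sum>n. b z n * cnj (b w n))"
  have B: "psd Y B" for Y unfolding B_def by (rule unit_ball_gram(1)[OF b])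
  have KB: "K z w * (1 - B z w) = 1" for z w
  proof -
    have "1 - B z w \<noteq> 0" using unit_ball_gram(2)[OF b, of z w] by (auto simp: B_def)
    moreover have "K z w = 1 / (1 - B z w)" using Kb[of z w] by (simp add: B_def)
    ultimately show ?thesis by simp
  qed
  define \<Phi> where "\<Phi> k = \<phi> (k mod M) (k div M)" for k
  \<comment> \<open>Inverse of the indexing of the stacked column: entry \<open>(i, j)\<close> has
    position \<open>j * M + i\<close>, from which \<open>mod M\<close> and \<open>div M\<close>
    recover \<open>i\<close> and \<open>j\<close>.\<close>
  define f where "f p = (fst (fst p), snd p * M + snd (fst p))" for p :: "('x \<times> nat) \<times> nat"
  have kM: "k mod M < M" "k div M < N" if "k < N * M" for k
  proof -
    have "0 < M" using that by (cases M) auto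
    then show "k mod M < M" "k div M < N" using that by (simp_all add: less_mult_imp_div_less)
  qed
  have col: "psd (Y \<times> {..<N * M}) (column_kernel K K (\<lambda>p. \<Phi> (snd p) (fst p)))"
    by (rule psd_of_column_bound) (use kM mem bound in \<open>auto simp: \<Phi>_def\<close>)
  have f: "f ` ((Y \<times> {..<M}) \<times> {..<N}) \<subseteq> Y \<times> {..<N * M}"
  proof -
    have "j * M + i < N * M" if "i < M" "j < N" for i j
    proof -
      have "j * M + i < Suc j * M" using that by simp
      also have "\<dots> \<le> N * M" using that by (intro mult_le_mono1) simp
      finally show ?thesis .
    qed
    then show ?thesis by (auto simp: f_def)
  qed
  define \<phi>' where "\<phi>' p = \<phi> (snd (fst p)) (snd p) (fst (fst p))" for p :: "('x \<times> nat) \<times> nat"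
  have "psd ((Y \<times> {..<M}) \<times> {..<N}) (\<lambda>p q. column_kernel K K (\<lambda>p. \<Phi> (snd p) (fst p)) (f p) (f q))"
    by (rule psd_pullback[OF col _ _ f]) (use Y in auto)
  moreover have "column_kernel K K (\<lambda>p. \<Phi> (snd p) (fst p)) (f p) (f q) =
      of_bool (snd (fst p) = snd (fst q)) * of_bool (snd p = snd q) * (K (fst (fst p)) (fst (fst q)) * 1)
        - K (fst (fst p)) (fst (fst q)) * (\<phi>' p * cnj (\<phi>' q))"
    if pq: "p \<in> (Y \<times> {..<M}) \<times> {..<N}" "q \<in> (Y \<times> {..<M}) \<times> {..<N}" for p q
  proof -
    have dm: "(snd p * M + snd (fst p)) mod M = snd (fst p)" "(snd p * M + snd (fst p)) div M = snd p"
      if "p \<in> (Y \<times> {..<M}) \<times> {..<N}" for p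
      using that by auto
    have "snd p * M + snd (fst p) = snd q * M + snd (fst q) \<longleftrightarrow> snd (fst p) = snd (fst q) \<and> snd p = snd q"
      using dm[OF pq(1)] dm[OF pq(2)] by metis
    moreover have "snd (fst p) < M" "snd (fst q) < M" using pq by auto
    ultimately show ?thesis
      by (simp add: column_kernel_def f_def \<Phi>_def \<phi>'_def dm[OF pq(1)] dm[OF pq(2)])
  qed
  ultimately have st: "psd ((Y \<times> {..<M}) \<times> {..<N}) (\<lambda>p q. of_bool (snd (fst p) = snd (fst q)) * of_bool (snd p = snd q) *
      (K (fst (fst p)) (fst (fst q)) * 1) - K (fst (fst p)) (fst (fst q)) * (\<phi>' p * cnj (\<phi>' q)))"
    by (subst (asm) psd_cong) assumption+
  \<comment> \<open>Source and target kernels coincide here, so the extra factor \<open>P\<close> is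
    the constant kernel \<open>1\<close>.\<close>
  have one: "psd Y (\<lambda>_ _. 1)" using psd_outer[of Y "\<lambda>_. 1"] by simp
  have "psd (Y \<times> {..<M}) (\<lambda>p q. of_bool (snd p = snd q) * (K (fst p) (fst q) * 1)
      - K (fst p) (fst q) * (\<Sum>j<N. \<phi>' (p, j) * cnj (\<phi>' (q, j))))"
    by (rule psd_matrix_of_stacked[OF Y psd_kernel B one KB _ st])
      (unfold column_kernel_same[symmetric], rule row_of_column[OF Y psd_kernel B KB])
  then show "psd (Y \<times> {..<M}) (\<lambda>p q. of_bool (snd p = snd q) * K (fst p) (fst q)
      - K (fst p) (fst q) * (\<Sum>j<N. \<phi> (snd p) j (fst p) * cnj (\<phi> (snd q) j (fst q))))"
    by (simp add: \<phi>'_def)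
qed

end

theorem corollary3p16:
  fixes H :: "('x \<Rightarrow> complex) set"
    and ip :: "('x \<Rightarrow> complex) \<Rightarrow> ('x \<Rightarrow> complex) \<Rightarrow> complex"
    and K :: "'x \<Rightarrow> 'x \<Rightarrow> complex"
    and M N :: nat
    and \<psi> :: "nat \<Rightarrow> nat \<Rightarrow> 'x \<Rightarrow> complex"
  assumes "normalized_complete_pick_space H ip K"
    and "\<And>i j. i < M \<Longrightarrow> j < N \<Longrightarrow> \<psi> i j \<in> Mult H"
  shows "mult_norm H ip M N \<psi> \<le> mult_norm H ip (N * M) 1 (stacked_column M \<psi>)"
proof (rule ennreal_le_epsilon)
  interpret normalized_complete_pick_space H ip K by (rule assms(1))
  have mem: "(\<lambda>x. \<psi> i j x * f x) \<in> H" if "i < M" "j < N" "f \<in> H" for i j f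
    using assms(2)[OF that(1,2)] that(3) by (auto simp: Mult_def)
  have tn: "tensor_norm ip n F = sqrt (\<Sum>i<n. sqnorm (F i))" for n F
    by (simp add: tensor_norm_def sqnorm_def)
  fix e :: real
  assume e: "0 < e" and fin: "mult_norm H ip (N * M) 1 (stacked_column M \<psi>) < top"
  define C where "C = enn2real (mult_norm H ip (N * M) 1 (stacked_column M \<psi>))"
  have C: "mult_norm H ip (N * M) 1 (stacked_column M \<psi>) = ennreal C" "0 \<le> C"
    using fin by (auto simp: C_def)
  have kM: "k mod M < M" "k div M < N" if "k < N * M" for k
  proof -
    have "0 < M" using that by (cases M) auto
    then show "k mod M < M" "k div M < N" using that by (simp_all add: less_mult_imp_div_less)
  qed
  have unit: "(\<Sum>k<N * M. sqnorm (\<lambda>x. \<psi> (k mod M) (k div M) x * f x)) \<le> C\<^sup>2"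
    if f: "f \<in> H" "sqnorm f \<le> 1" for f
  proof -
    define F where "F = (\<lambda>i\<in>{..<1::nat}. f)"
    have "F \<in> {F \<in> tensor_Cn H 1. tensor_norm ip 1 F \<le> 1}"
      using f by (auto simp: F_def tensor_Cn_def tn)
    then have "ennreal (tensor_norm ip (N * M) (mult_operator (N * M) 1 (stacked_column M \<psi>) F)) \<le> ennreal C"
      unfolding C(1)[symmetric] mult_norm_def by (rule SUP_upper)
    then have "tensor_norm ip (N * M) (mult_operator (N * M) 1 (stacked_column M \<psi>) F) \<le> C"
      using C(2) by simp
    moreover have "tensor_norm ip (N * M) (mult_operator (N * M) 1 (stacked_column M \<psi>) F) =
        sqrt (\<Sum>k<N * M. sqnorm (\<lambda>x. \<psi> (k mod M) (k div M) x * f x))"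
      unfolding tn by (intro arg_cong[where f = sqrt] sum.cong refl)
        (simp add: mult_operator_def stacked_column_def F_def)
    ultimately show ?thesis by (simp add: sqrt_le_D)
  qed
  have col: "(\<Sum>k<N * M. sqnorm (\<lambda>x. \<psi> (k mod M) (k div M) x * f x)) \<le> C\<^sup>2 * sqnorm f"
    if f: "f \<in> H" for f
  proof (cases "sqnorm f = 0")
    case True
    then have "f = (\<lambda>x. 0)" by (rule sqnorm_zero[OF f])
    then show ?thesis using ip_zero[OF zero_mem] by (simp add: sqnorm_def)
  next
    case False
    then have pos: "0 < sqnorm f" using sqnorm_nonneg[OF f] by simp
    define r where "r = complex_of_real (1 / sqrt (sqnorm f))"
    have r: "(cmod r)\<^sup>2 = 1 / sqnorm f" using pos by (simp add: r_def norm_divide power_divide)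
    have "sqnorm (\<lambda>x. \<psi> (k mod M) (k div M) x * (r * f x)) = sqnorm (\<lambda>x. \<psi> (k mod M) (k div M) x * f x) / sqnorm f"
      if "k < N * M" for k
      using sqnorm_scale[OF mem[OF kM[OF that] f], of r] by (simp add: r mult_ac)
    then have "(\<Sum>k<N * M. sqnorm (\<lambda>x. \<psi> (k mod M) (k div M) x * f x)) / sqnorm f \<le> C\<^sup>2"
      using unit[OF scale_mem[OF f, of r]] sqnorm_scale[OF f, of r] pos by (simp add: r sum_divide_distrib)
    then show ?thesis using pos by (simp add: field_simps)
  qed
  \<comment> \<open>The slack \<open>e\<close> permits division by \<open>c\<close> even when the
    stacked column has norm \<open>0\<close>.\<close>
  define c where "c = C + e"
  have c: "0 < c" using C(2) e by (simp add: c_def)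
  define \<phi> where "\<phi> i j x = \<psi> i j x / of_real c" for i j x
  have \<phi>: "(\<lambda>x. \<phi> i j x * f x) = (\<lambda>x. of_real (1 / c) * (\<psi> i j x * f x))" for i j f
    by (simp add: \<phi>_def)
  have col': "(\<Sum>k<N * M. sqnorm (\<lambda>x. \<phi> (k mod M) (k div M) x * f x)) \<le> sqnorm f" if f: "f \<in> H" for f
  proof -
    have "(\<Sum>k<N * M. sqnorm (\<lambda>x. \<phi> (k mod M) (k div M) x * f x)) =
        (\<Sum>k<N * M. sqnorm (\<lambda>x. \<psi> (k mod M) (k div M) x * f x)) / c\<^sup>2"
      unfolding sum_divide_distrib \<phi> using sqnorm_scale[OF mem[OF kM f], where c = "of_real (1 / c)"]
      by (intro sum.cong refl) (simp add: power_divide del: of_real_divide)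
    also have "\<dots> \<le> C\<^sup>2 * sqnorm f / c\<^sup>2" by (intro divide_right_mono col f) simp
    also have "\<dots> \<le> sqnorm f"
    proof -
      have "C\<^sup>2 * sqnorm f \<le> c\<^sup>2 * sqnorm f"
        using C(2) e by (intro mult_right_mono power_mono sqnorm_nonneg f) (auto simp: c_def)
      then show ?thesis using c by (simp add: field_simps)
    qed
    finally show ?thesis .
  qed
  have "mult_norm H ip M N \<psi> \<le> ennreal c"
    unfolding mult_norm_def
  proof (rule SUP_least)
    fix F assume "F \<in> {F \<in> tensor_Cn H N. tensor_norm ip N F \<le> 1}"
    then have F: "\<And>j. j < N \<Longrightarrow> F j \<in> H" and F1: "(\<Sum>j<N. sqnorm (F j)) \<le> 1"
      by (auto simp: tensor_Cn_def tn PiE_iff)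
    have g: "(\<lambda>z. \<Sum>j<N. \<psi> i j z * F j z) \<in> H" if "i < M" for i
      using that by (intro sum_mem mem F) auto
    have "(\<Sum>i<M. sqnorm (\<lambda>z. \<Sum>j<N. \<phi> i j z * F j z)) \<le> (\<Sum>j<N. sqnorm (F j))"
      by (rule matrix_bound[OF _ col' F]) (unfold \<phi>, intro scale_mem mem)
    moreover have "sqnorm (\<lambda>z. \<Sum>j<N. \<phi> i j z * F j z) = sqnorm (\<lambda>z. \<Sum>j<N. \<psi> i j z * F j z) / c\<^sup>2"
      if "i < M" for i
    proof -
      have "(\<lambda>z. \<Sum>j<N. \<phi> i j z * F j z) = (\<lambda>z. of_real (1 / c) * (\<Sum>j<N. \<psi> i j z * F j z))"
        by (simp add: \<phi>_def sum_divide_distrib)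
      then show ?thesis using sqnorm_scale[OF g[OF that], of "of_real (1 / c)"] by (simp add: power_divide del: of_real_divide)
    qed
    ultimately have "(\<Sum>i<M. sqnorm (\<lambda>z. \<Sum>j<N. \<psi> i j z * F j z)) / c\<^sup>2 \<le> 1"
      using F1 by (simp add: sum_divide_distrib)
    then have "(\<Sum>i<M. sqnorm (\<lambda>z. \<Sum>j<N. \<psi> i j z * F j z)) \<le> c\<^sup>2"
      using c by (simp add: field_simps)
    then have "sqrt (\<Sum>i<M. sqnorm (\<lambda>z. \<Sum>j<N. \<psi> i j z * F j z)) \<le> c"
      using c real_le_lsqrt[of c] by (intro real_le_lsqrt) (auto intro!: sum_nonneg sqnorm_nonneg g)
    moreover have "tensor_norm ip M (mult_operator M N \<psi> F) = sqrt (\<Sum>i<M. sqnorm (\<lambda>z. \<Sum>j<N. \<psi> i j z * F j z))"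
      unfolding tn by (intro arg_cong[where f = sqrt] sum.cong refl) (simp add: mult_operator_def)
    ultimately show "ennreal (tensor_norm ip M (mult_operator M N \<psi> F)) \<le> ennreal c"
      by (simp add: ennreal_leI)
  qed
  also have "ennreal c = mult_norm H ip (N * M) 1 (stacked_column M \<psi>) + ennreal e"
    unfolding c_def C(1) using C(2) e by (simp add: ennreal_plus)
  finally show "mult_norm H ip M N \<psi> \<le> mult_norm H ip (N * M) 1 (stacked_column M \<psi>) + ennreal e" .
qed

end
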